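(* Let $\theta$ be an inner function and $\mathbb D^-=\mathbb C\setminus(\mathbb D\cup\mathbb T)$. If $\lambda\in\mathbb T\cup\mathbb D^-$, or if $\lambda\in\mathbb D$ and $\theta(0)\neq0$, then $\ker D_{z-\lambda}^\theta=\ker D_{\bar z-\bar\lambda}^\theta=\{0\}$. If $\lambda\in\mathbb D$ and $\theta(0)=0$, then $$\ker D_{z-\lambda}^\theta=\operatorname{span}\left\{\tfrac1{z-\lambda}\right\}\subset H^2_-\qquad\text{and}\qquad \ker D_{\bar z-\bar\lambda}^\theta=\operatorname{span}\left\{\tfrac{\theta}{1-\bar\lambda z}\right\}\subset\theta H^2.$$
   Context: $L^2=L^2(\mathbb T)$, $\mathbb T$ the unit circle; $H^2$ is the Hardy space of the unit disk $\mathbb D$, viewed as a subspace of $L^2$, and $H^2_-=\bar z\,\overline{H^2}=L^2\ominus H^2$. For an inner function $\theta$, $K_\theta=H^2\ominus\theta H^2$, $(K_\theta)^\perp=L^2\ominus K_\theta=H^2_-\oplus\theta H^2$, and $Q_\theta$ is the orthogonal projection of $L^2$ onto $(K_\theta)^\perp$. For $\varphi\in L^\infty(\mathbb T)$, $D_\varphi^{\theta}\colon (K_\theta)^\perp\to(K_\theta)^\perp$ is the dual truncated Toeplitz operator $D_\varphi^{\theta}f=Q_\theta(\varphi f)$. *)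

theory Defs
  imports "HOL-Complex_Analysis.Complex_Analysis"
begin

section \<open>The space \<open>L\<^sup>2\<close> of the unit circle\<close>

text \<open>Normalised arc length. Its underlying space is the circle itself, so the values of a
  function off the circle play no role for measurability or integration.\<close>

definition circle_measure :: "complex measure" where
  "circle_measure =
     distr (uniform_measure lborel {0..2 * pi}) (restrict_space borel (sphere 0 1)) cis"

definition square_integrable :: "(complex \<Rightarrow> complex) \<Rightarrow> bool" where
  "square_integrable f \<longleftrightarrow>
     f \<in> borel_measurable circle_measure \<and> integrable circle_measure (\<lambda>z. (cmod (f z))\<^sup>2)"

definition ess_bounded :: "(complex \<Rightarrow> complex) \<Rightarrow> bool" where
  "ess_bounded \<phi> \<longleftrightarrow>
     \<phi> \<in> borel_measurable circle_measure \<and> (\<exists>C. AE z in circle_measure. cmod (\<phi> z) \<le> C)"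

definition l2_eq :: "(complex \<Rightarrow> complex) \<Rightarrow> (complex \<Rightarrow> complex) \<Rightarrow> bool" where
  "l2_eq f g \<longleftrightarrow>
     square_integrable f \<and> square_integrable g \<and> (AE z in circle_measure. f z = g z)"

lemma square_integrable_zero: "square_integrable (\<lambda>z. 0)"
  by (simp add: square_integrable_def)

lemma square_integrable_mult:
  assumes "ess_bounded \<phi>" "square_integrable f"
  shows "square_integrable (\<lambda>z. \<phi> z * f z)"
proof -
  obtain C where C: "AE z in circle_measure. cmod (\<phi> z) \<le> C"
    and [measurable]: "\<phi> \<in> borel_measurable circle_measure"
    using assms(1) by (auto simp: ess_bounded_def)
  have [measurable]: "f \<in> borel_measurable circle_measure"
    and int: "integrable circle_measure (\<lambda>z. (cmod (f z))\<^sup>2)"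
    using assms(2) by (auto simp: square_integrable_def)
  have "integrable circle_measure (\<lambda>z. (cmod (\<phi> z * f z))\<^sup>2)"
  proof (rule Bochner_Integration.integrable_bound)
    show "integrable circle_measure (\<lambda>z. C\<^sup>2 * (cmod (f z))\<^sup>2)"
      using int by simp
    show "AE z in circle_measure.
        norm ((cmod (\<phi> z * f z))\<^sup>2) \<le> norm (C\<^sup>2 * (cmod (f z))\<^sup>2)"
      using C by eventually_elim
        (auto simp: norm_mult power_mult_distrib intro!: mult_right_mono power_mono)
  qed measurable
  then show ?thesis
    by (simp add: square_integrable_def)
qed

lemma square_integrable_scale:
  "square_integrable f \<Longrightarrow> square_integrable (\<lambda>z. c * f z)"
  by (rule square_integrable_mult) (auto simp: ess_bounded_def)

lemma square_integrable_add:
  assumes "square_integrable f" "square_integrable g"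
  shows "square_integrable (\<lambda>z. f z + g z)"
proof -
  have [measurable]: "f \<in> borel_measurable circle_measure" "g \<in> borel_measurable circle_measure"
    and int: "integrable circle_measure (\<lambda>z. (cmod (f z))\<^sup>2)"
      "integrable circle_measure (\<lambda>z. (cmod (g z))\<^sup>2)"
    using assms by (auto simp: square_integrable_def)
  have le: "(cmod (a + b))\<^sup>2 \<le> 2 * (cmod a)\<^sup>2 + 2 * (cmod b)\<^sup>2" for a b :: complex
  proof -
    have "(cmod (a + b))\<^sup>2 \<le> (cmod a + cmod b)\<^sup>2"
      by (simp add: norm_triangle_ineq power_mono)
    also have "\<dots> \<le> 2 * (cmod a)\<^sup>2 + 2 * (cmod b)\<^sup>2"
      using sum_squares_bound[of "cmod a" "cmod b"] by (simp add: power2_sum)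
    finally show ?thesis .
  qed
  have "integrable circle_measure (\<lambda>z. (cmod (f z + g z))\<^sup>2)"
    by (rule Bochner_Integration.integrable_bound
          [of _ "\<lambda>z. 2 * (cmod (f z))\<^sup>2 + 2 * (cmod (g z))\<^sup>2"])
       (use int le in auto)
  then show ?thesis
    by (simp add: square_integrable_def)
qed

lemma square_integrable_uminus: "square_integrable f \<Longrightarrow> square_integrable (\<lambda>z. - f z)"
  by (simp add: square_integrable_def)

lemma square_integrable_diff:
  "square_integrable f \<Longrightarrow> square_integrable g \<Longrightarrow> square_integrable (\<lambda>z. f z - g z)"
  using square_integrable_add[of f "\<lambda>z. - g z"] square_integrable_uminus[of g] by simp

lemma borel_measurable_cnj:
  "f \<in> borel_measurable M \<Longrightarrow> (\<lambda>z. cnj (f z)) \<in> borel_measurable M"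
  by (rule borel_measurable_continuous_on) (auto intro: continuous_intros)

lemma square_integrable_cnj: "square_integrable f \<Longrightarrow> square_integrable (\<lambda>z. cnj (f z))"
  by (auto simp: square_integrable_def intro: borel_measurable_cnj)

quotient_type l2 = "complex \<Rightarrow> complex" / partial: l2_eq
  morphisms rep_l2 l2_of
proof (rule part_equivpI)
  show "\<exists>f. l2_eq f f"
    using square_integrable_zero by (auto simp: l2_eq_def)
  show "symp l2_eq"
    by (auto simp: symp_def l2_eq_def elim!: AE_mp)
  show "transp l2_eq"
    unfolding transp_def l2_eq_def by (auto elim: eventually_elim2)
qed

instantiation l2 :: ab_group_add
begin

lift_definition zero_l2 :: l2 is "\<lambda>z. 0"
  by (simp add: l2_eq_def square_integrable_zero)

lift_definition plus_l2 :: "l2 \<Rightarrow> l2 \<Rightarrow> l2" is "\<lambda>f g z. f z + g z"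
  unfolding l2_eq_def by (auto simp: square_integrable_add elim: eventually_elim2)

lift_definition uminus_l2 :: "l2 \<Rightarrow> l2" is "\<lambda>f z. - f z"
  unfolding l2_eq_def by (auto simp: square_integrable_uminus)

lift_definition minus_l2 :: "l2 \<Rightarrow> l2 \<Rightarrow> l2" is "\<lambda>f g z. f z - g z"
  unfolding l2_eq_def by (auto simp: square_integrable_diff elim: eventually_elim2)

instance
proof
  fix a b c :: l2
  show "a + b + c = a + (b + c)"
    by transfer (auto simp: l2_eq_def square_integrable_add algebra_simps)
  show "a + b = b + a"
    by transfer (auto simp: l2_eq_def square_integrable_add algebra_simps)
  show "0 + a = a"
    by transfer (auto simp: l2_eq_def)
  show "- a + a = 0"
    by transfer (auto simp: l2_eq_def square_integrable_zero)
  show "a - b = a + - b"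
    by transfer (auto simp: l2_eq_def square_integrable_diff)
qed

end

lift_definition scaleC_l2 :: "complex \<Rightarrow> l2 \<Rightarrow> l2" is "\<lambda>c f z. c * f z"
  unfolding l2_eq_def by (auto simp: square_integrable_scale)

global_interpretation l2: vector_space scaleC_l2
proof
  fix a b :: complex and x y :: l2
  show "scaleC_l2 a (x + y) = scaleC_l2 a x + scaleC_l2 a y"
    by transfer
      (auto simp: l2_eq_def square_integrable_add square_integrable_scale algebra_simps)
  show "scaleC_l2 (a + b) x = scaleC_l2 a x + scaleC_l2 b x"
    by transfer
      (auto simp: l2_eq_def square_integrable_add square_integrable_scale distrib_right)
  show "scaleC_l2 a (scaleC_l2 b x) = scaleC_l2 (a * b) x"
    by transfer (auto simp: l2_eq_def square_integrable_scale mult.assoc)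
  show "scaleC_l2 1 x = x"
    by transfer (auto simp: l2_eq_def)
qed

lift_definition cnj_l2 :: "l2 \<Rightarrow> l2" is "\<lambda>f z. cnj (f z)"
  unfolding l2_eq_def by (auto simp: square_integrable_cnj)

lift_definition cinner_l2 :: "l2 \<Rightarrow> l2 \<Rightarrow> complex" is
  "\<lambda>f g. integral\<^sup>L circle_measure (\<lambda>z. f z * cnj (g z))"
  by (rule integral_cong_AE)
    (auto simp: l2_eq_def square_integrable_def intro!: borel_measurable_times borel_measurable_cnj
      elim: eventually_elim2)

definition norm_l2 :: "l2 \<Rightarrow> real" where
  "norm_l2 f = sqrt (Re (cinner_l2 f f))"

text \<open>Multiplication by a symbol in \<open>L\<^sup>\<infinity>\<close>; the value for other symbols is a dummy.\<close>

lift_definition mult_l2 :: "(complex \<Rightarrow> complex) \<Rightarrow> l2 \<Rightarrow> l2" is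
  "\<lambda>\<phi> f z. if ess_bounded \<phi> then \<phi> z * f z else 0"
  subgoal for \<phi>
    by (cases "ess_bounded \<phi>") (auto simp: l2_eq_def square_integrable_mult square_integrable_zero)
  done

definition ortho_compl :: "l2 set \<Rightarrow> l2 set" where
  "ortho_compl M = {f. \<forall>g\<in>M. cinner_l2 f g = 0}"

text \<open>Meaningful for closed subspaces \<open>M\<close>.\<close>

definition ortho_proj :: "l2 set \<Rightarrow> l2 \<Rightarrow> l2" where
  "ortho_proj M f = (THE g. g \<in> M \<and> f - g \<in> ortho_compl M)"

section \<open>Hardy space and inner functions\<close>

definition hardy_disk :: "(complex \<Rightarrow> complex) set" where
  "hardy_disk = {F. F holomorphic_on ball 0 1 \<and>
     (\<exists>C. \<forall>r. 0 \<le> r \<and> r < 1 \<longrightarrow>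
        integral\<^sup>L circle_measure (\<lambda>z. (cmod (F (of_real r * z)))\<^sup>2) \<le> C)}"

text \<open>The Hardy space of the disk as a subspace of \<open>L\<^sup>2\<close>: a function in \<open>hardy_disk\<close> is identified
  with its boundary function, the \<open>L\<^sup>2\<close>-limit of its dilations \<open>z \<mapsto> F (r z)\<close> as \<open>r\<close>
  tends to \<open>1\<close> from below.\<close>

definition H2 :: "l2 set" where
  "H2 = {f. \<exists>F\<in>hardy_disk.
     ((\<lambda>r::real. norm_l2 (l2_of (\<lambda>z. F (of_real r * z)) - f)) \<longlongrightarrow> 0) (at_left 1)}"

definition H2_minus :: "l2 set" where
  "H2_minus = (\<lambda>f. mult_l2 cnj (cnj_l2 f)) ` H2"

definition radial_limit :: "(complex \<Rightarrow> complex) \<Rightarrow> complex \<Rightarrow> complex" where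
  "radial_limit F z = Lim (at_left 1) (\<lambda>r::real. F (of_real r * z))"

text \<open>An inner function is given as a function on the disk; on the circle it is represented by
  \<open>radial_limit \<theta>\<close>.\<close>

definition inner_function :: "(complex \<Rightarrow> complex) \<Rightarrow> bool" where
  "inner_function \<theta> \<longleftrightarrow>
     \<theta> holomorphic_on ball 0 1 \<and> bounded (\<theta> ` ball 0 1) \<and>
     (AE z in circle_measure.
        ((\<lambda>r::real. \<theta> (of_real r * z)) \<longlongrightarrow> radial_limit \<theta> z) (at_left 1) \<and>
        cmod (radial_limit \<theta> z) = 1)"

definition inner_H2 :: "(complex \<Rightarrow> complex) \<Rightarrow> l2 set" where
  "inner_H2 \<theta> = mult_l2 (radial_limit \<theta>) ` H2"

definition model_space :: "(complex \<Rightarrow> complex) \<Rightarrow> l2 set" where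
  "model_space \<theta> = H2 \<inter> ortho_compl (inner_H2 \<theta>)"

section \<open>Dual truncated Toeplitz operators\<close>

text \<open>The operator is only considered on its domain \<open>ortho_compl (model_space \<theta>)\<close>.\<close>

definition dual_tto ::
    "(complex \<Rightarrow> complex) \<Rightarrow> (complex \<Rightarrow> complex) \<Rightarrow> l2 \<Rightarrow> l2" where
  "dual_tto \<theta> \<phi> f = ortho_proj (ortho_compl (model_space \<theta>)) (mult_l2 \<phi> f)"

definition ker_dual_tto :: "(complex \<Rightarrow> complex) \<Rightarrow> (complex \<Rightarrow> complex) \<Rightarrow> l2 set" where
  "ker_dual_tto \<theta> \<phi> = {f \<in> ortho_compl (model_space \<theta>). dual_tto \<theta> \<phi> f = 0}"

end

theory Submission
  imports Defs "HOL-Probability.Probability_Measure"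
begin

text \<open>
  Write \<open>K\<close> for the model space. The explicit decomposition of \<open>L\<^sup>2\<close> into the orthogonal complement of
  \<open>H\<^sup>2\<close>, the subspace \<open>\<theta> H\<^sup>2\<close> and \<open>K\<close> (\<open>model_space_decomposition\<close>) shows that \<open>x\<close> is in the kernel of the dual
  truncated Toeplitz operator with symbol \<open>\<phi>\<close> exactly when \<open>x = m + \<theta> p\<close> with \<open>m\<close> orthogonal to \<open>H\<^sup>2\<close> and \<open>p\<close> in
  \<open>H\<^sup>2\<close>, and \<open>\<phi> x\<close> lies in \<open>K\<close>.

  For \<open>\<phi> = z - l\<close>, the condition \<open>\<phi> x \<in> H\<^sup>2\<close> forces \<open>(z - l) m\<close> to be a constant \<open>c\<close>, and orthogonality to
  \<open>\<theta> H\<^sup>2\<close> then gives \<open>(z - l) p = - c * cnj (\<theta> 0)\<close> (\<open>ker_shift_equations\<close>). If \<open>l\<close> is in the disk,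
  \<open>1 / (z - l)\<close> is orthogonal to \<open>H\<^sup>2\<close>, so \<open>p = 0\<close> and \<open>x = c / (z - l)\<close> with \<open>c * \<theta> 0 = 0\<close>. If \<open>l\<close> is not in the
  disk, the Fourier coefficients of \<open>m\<close> of negative index form a geometric sequence that starts with \<open>c\<close>
  and whose ratio has modulus at least \<open>1\<close>, which contradicts Bessel's inequality unless \<open>c = 0\<close>
  (\<open>resolvent_const_exterior\<close>).

  The symbol \<open>cnj z - cnj l\<close> is treated in the same way with the roles of the two components exchanged
  (\<open>ker_conj_shift_equations\<close>): now \<open>(1 - cnj l * z) p\<close> is a constant \<open>c\<close>, the coefficients of \<open>p\<close> are
  geometric, and the part of \<open>c * cnj z * \<theta>\<close> outside \<open>H\<^sup>2\<close>, namely \<open>c * \<theta> 0 * cnj z\<close>, has to vanish.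

  The analytic input consists of the completeness of \<open>L\<^sup>2\<close>, the splitting of every vector into a part in
  \<open>H\<^sup>2\<close> and a part orthogonal to \<open>H\<^sup>2\<close> (\<open>riesz_decomposition\<close>), the invariance of \<open>H\<^sup>2\<close> under bounded analytic
  multipliers, with the value at the origin being multiplicative (\<open>h2_boundary_mult\<close> and
  \<open>coef_0_h2_boundary\<close>), and the measurability of radial limits.
\<close>

section \<open>Integration over the circle\<close>

lemma space_circle [simp]: "space circle_measure = sphere 0 1"
  by (simp add: circle_measure_def space_restrict_space)

lemma sets_circle [measurable_cong]: "sets circle_measure = sets (restrict_space borel (sphere 0 1))"
  by (simp add: circle_measure_def)

lemma measurable_cis:
  "cis \<in> measurable (uniform_measure lborel {0..2 * pi}) (restrict_space borel (sphere 0 1))"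
proof (rule measurable_restrict_space2)
  have "continuous_on UNIV cis"
    unfolding cis_conv_exp by (intro continuous_intros)
  then have "cis \<in> borel_measurable borel"
    by (rule borel_measurable_continuous_onI)
  then show "cis \<in> borel_measurable (uniform_measure lborel {0..2 * pi})"
    by simp
qed auto

interpretation circle: prob_space circle_measure
  unfolding circle_measure_def
  by (intro prob_space.prob_space_distr prob_space_uniform_measure measurable_cis) auto

lemma continuous_on_circle_measurable:
  fixes f :: "complex \<Rightarrow> complex"
  assumes "continuous_on (sphere 0 1) f"
  shows "f \<in> borel_measurable circle_measure"
  using borel_measurable_continuous_on_restrict[OF assms] measurable_cong_sets[OF sets_circle refl]
  by blast

lemma continuous_on_circle_ess_bounded:
  assumes "continuous_on (sphere 0 1) f"
  shows "ess_bounded f"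
proof -
  have "compact (f ` sphere 0 1)"
    by (intro compact_continuous_image assms) auto
  then obtain C where "\<And>z. z \<in> sphere 0 1 \<Longrightarrow> cmod (f z) \<le> C"
    by (meson bounded_iff compact_imp_bounded imageI)
  then have "AE z in circle_measure. cmod (f z) \<le> C"
    by (intro AE_I2) auto
  then show ?thesis
    unfolding ess_bounded_def using continuous_on_circle_measurable[OF assms] by blast
qed

lemma ess_bounded_square_integrable:
  assumes "ess_bounded f" shows "square_integrable f"
proof -
  have "square_integrable (\<lambda>z. 1)"
    by (simp add: square_integrable_def)
  from square_integrable_mult[OF assms this] show ?thesis by simp
qed

lemma integral_circle_power:
  assumes "n > 0"
  shows "integral\<^sup>L circle_measure (\<lambda>z. z ^ n) = 0"
proof -
  let ?I = "{0..2 * pi}"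
  have "integral\<^sup>L circle_measure (\<lambda>z. z ^ n)
      = integral\<^sup>L (uniform_measure lborel ?I) (\<lambda>t. cis t ^ n)"
    unfolding circle_measure_def
    by (rule integral_distr[OF measurable_cis])
      (intro borel_measurable_continuous_on_restrict continuous_intros)
  also have "\<dots> = integral\<^sup>L (density lborel (\<lambda>t. ennreal (indicator ?I t / (2 * pi)))) (\<lambda>t. cis t ^ n)"
    unfolding uniform_measure_def
    by (intro arg_cong2[where f = "integral\<^sup>L"] arg_cong2[where f = density] refl ext)
      (auto simp: indicator_def divide_ennreal[symmetric] ennreal_1[symmetric] simp del: ennreal_1)
  also have "\<dots> = integral\<^sup>L lborel (\<lambda>t. (indicator ?I t / (2 * pi)) *\<^sub>R (cis t ^ n))"
  proof (rule integral_density)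
    have "continuous_on UNIV (\<lambda>t. cis t ^ n)"
      unfolding cis_conv_exp by (intro continuous_intros)
    then show "(\<lambda>t. cis t ^ n) \<in> borel_measurable lborel"
      using borel_measurable_continuous_onI by simp
  qed auto
  also have "\<dots> = integral\<^sup>L lborel (\<lambda>t. indicator ?I t *\<^sub>R (cis (real n * t) / (2 * pi)))"
    by (intro Bochner_Integration.integral_cong refl) (auto simp: indicator_def Complex.DeMoivre scaleR_conv_of_real)
  also have "\<dots> = cis (real n * (2 * pi)) / (\<i> * n * (2 * pi)) - cis (real n * 0) / (\<i> * n * (2 * pi))"
  proof (rule integral_FTC_atLeastAtMost)
    fix t :: real
    have "((\<lambda>w. exp (\<i> * n * w) / (\<i> * n * (2 * pi))) has_field_derivative
        exp (\<i> * n * of_real t) / (2 * pi)) (at (of_real t))"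
      using assms by (auto intro!: derivative_eq_intros simp: field_simps)
    from has_vector_derivative_real_field[OF this, of ?I]
    show "((\<lambda>t. cis (real n * t) / (\<i> * n * (2 * pi))) has_vector_derivative
        cis (real n * t) / (2 * pi)) (at t within ?I)"
      by (simp add: cis_conv_exp mult.assoc)
    show "continuous_on ?I (\<lambda>t. cis (real n * t) / (2 * pi))"
      unfolding cis_conv_exp by (intro continuous_intros) auto
  qed simp
  also have "\<dots> = 0"
    using cis_multiple_2pi[of "real n"] by (simp add: mult.commute)
  finally show ?thesis .
qed

text \<open>Points are null, so multiplication by \<open>z - l\<close> is injective on \<open>L\<^sup>2\<close> even when \<open>l\<close> lies on the
  circle.\<close>

lemma AE_circle_neq: "AE z in circle_measure. z \<noteq> l"
proof -
  have "countable {t. cis t = l}"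
  proof (cases "\<exists>a. cis a = l")
    case True
    then obtain a where a: "cis a = l" by blast
    have "{t. cis t = l} \<subseteq> range (\<lambda>k::int. a + 2 * pi * k)"
    proof
      fix t assume "t \<in> {t. cis t = l}"
      then have "cos t = cos a" "sin t = sin a"
        using a by (auto simp: complex_eq_iff)
      then obtain k :: int where "t = a + 2 * pi * k"
        using sin_cos_eq_iff by (metis )
      then show "t \<in> range (\<lambda>k::int. a + 2 * pi * k)" by blast
    qed
    then show ?thesis
      by (rule countable_subset) auto
  qed auto
  then have null: "{t. cis t = l} \<in> null_sets lborel"
    by (rule countable_imp_null_set_lborel)
  have "AE t in uniform_measure lborel {0..2 * pi}. cis t \<noteq> l"
    by (rule AE_uniform_measureI) (use AE_not_in[OF null] in \<open>auto elim: eventually_mono\<close>)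
  then show ?thesis
    unfolding circle_measure_def
    by (subst AE_distr_iff[OF measurable_cis])
      (auto simp: sets_restrict_space image_iff intro!: bexI[of _ "- {l}"])
qed

section \<open>The Hilbert space structure of \<open>L\<^sup>2\<close>\<close>

lemma l2_of_cases [case_names l2_of, cases type: l2]:
  obtains f where "square_integrable f" "x = l2_of f"
proof -
  have "\<exists>f. square_integrable f \<and> x = l2_of f"
    by (induction x rule: l2.abs_induct) (auto simp: l2_eq_def)
  then show ?thesis using that by blast
qed

lemma l2_of_eq_iff:
  assumes "square_integrable f" "square_integrable g"
  shows "l2_of f = l2_of g \<longleftrightarrow> (AE z in circle_measure. f z = g z)"
  using Quotient3_rel[OF Quotient3_l2, of f g] assms by (auto simp: l2_eq_def)

lemma
  assumes "square_integrable f"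
  shows l2_of_scaleC: "scaleC_l2 c (l2_of f) = l2_of (\<lambda>z. c * f z)"
    and l2_of_cnj: "cnj_l2 (l2_of f) = l2_of (\<lambda>z. cnj (f z))"
    and l2_of_mult: "ess_bounded \<phi> \<Longrightarrow> mult_l2 \<phi> (l2_of f) = l2_of (\<lambda>z. \<phi> z * f z)"
  using assms
  by (simp_all add: scaleC_l2.abs_eq cnj_l2.abs_eq mult_l2.abs_eq l2_eq_def)

lemma
  assumes "square_integrable f" "square_integrable g"
  shows l2_of_add: "l2_of f + l2_of g = l2_of (\<lambda>z. f z + g z)"
    and l2_of_diff: "l2_of f - l2_of g = l2_of (\<lambda>z. f z - g z)"
    and cinner_l2_of: "cinner_l2 (l2_of f) (l2_of g) = integral\<^sup>L circle_measure (\<lambda>z. f z * cnj (g z))"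
  using assms
  by (simp_all add: plus_l2.abs_eq minus_l2.abs_eq cinner_l2.abs_eq l2_eq_def)

lemma integrable_mult_cnj:
  assumes "square_integrable f" "square_integrable g"
  shows "integrable circle_measure (\<lambda>z. f z * cnj (g z))"
proof (rule Bochner_Integration.integrable_bound)
  show "integrable circle_measure (\<lambda>z. (cmod (f z))\<^sup>2 + (cmod (g z))\<^sup>2)"
    using assms by (auto simp: square_integrable_def)
  show "(\<lambda>z. f z * cnj (g z)) \<in> borel_measurable circle_measure"
    using assms by (auto simp: square_integrable_def intro!: borel_measurable_times borel_measurable_cnj)
  show "AE z in circle_measure. norm (f z * cnj (g z)) \<le> norm ((cmod (f z))\<^sup>2 + (cmod (g z))\<^sup>2)"
  proof (intro AE_I2)
    fix z
    have "2 * (cmod (f z) * cmod (g z)) \<le> (cmod (f z))\<^sup>2 + (cmod (g z))\<^sup>2"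
      using sum_squares_bound[of "cmod (f z)" "cmod (g z)"] by simp
    moreover have "0 \<le> cmod (f z) * cmod (g z)" by simp
    ultimately have "cmod (f z) * cmod (g z) \<le> (cmod (f z))\<^sup>2 + (cmod (g z))\<^sup>2" by linarith
    then show "norm (f z * cnj (g z)) \<le> norm ((cmod (f z))\<^sup>2 + (cmod (g z))\<^sup>2)"
      by (simp add: norm_mult)
  qed
qed

lemma cinner_self:
  assumes "square_integrable f"
  shows "cinner_l2 (l2_of f) (l2_of f) = of_real (integral\<^sup>L circle_measure (\<lambda>z. (cmod (f z))\<^sup>2))"
  by (simp only: cinner_l2_of[OF assms assms] complex_norm_square[symmetric]
      of_real_power[symmetric] integral_complex_of_real)

lemma cinner_add_left: "cinner_l2 (x + y) z = cinner_l2 x z + cinner_l2 y z"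
  by (cases x; cases y; cases z)
    (simp add: l2_of_add cinner_l2_of square_integrable_add ring_distribs integrable_mult_cnj)

lemma cinner_scale_left: "cinner_l2 (scaleC_l2 c x) z = c * cinner_l2 x z"
  by (cases x; cases z)
    (simp add: l2_of_scaleC cinner_l2_of square_integrable_scale mult.assoc)

lemma cinner_commute: "cinner_l2 x y = cnj (cinner_l2 y x)"
  by (cases x; cases y) (simp add: cinner_l2_of mult.commute flip: Bochner_Integration.integral_cnj)

text \<open>Taking the real part of the complex inner product makes the library theory of real inner product
  spaces (Cauchy--Schwarz, the norm topology, series) available. The norm is \<open>norm_l2\<close>, so the limit
  in the definition of \<open>H2\<close> is a limit in this topology.\<close>

instantiation l2 :: real_inner
begin

definition inner_l2 :: "l2 \<Rightarrow> l2 \<Rightarrow> real" where "inner_l2 x y = Re (cinner_l2 x y)"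
definition scaleR_l2 :: "real \<Rightarrow> l2 \<Rightarrow> l2" where "scaleR_l2 r = scaleC_l2 (of_real r)"
definition norm_eq_norm_l2: "norm = Defs.norm_l2"
definition dist_l2 :: "l2 \<Rightarrow> l2 \<Rightarrow> real" where "dist_l2 x y = norm (x - y)"
definition sgn_l2 :: "l2 \<Rightarrow> l2" where "sgn_l2 x = inverse (norm x) *\<^sub>R x"
definition uniformity_l2 :: "(l2 \<times> l2) filter" where
  "uniformity_l2 = (INF e\<in>{0<..}. principal {(x, y). dist x y < e})"
definition open_l2 :: "l2 set \<Rightarrow> bool" where
  "open_l2 U \<longleftrightarrow> (\<forall>x\<in>U. \<forall>\<^sub>F (x', y) in uniformity. x' = x \<longrightarrow> y \<in> U)"

instance
proof
  fix x y z :: l2 and a b :: real and U :: "l2 set"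
  show "a *\<^sub>R (x + y) = a *\<^sub>R x + a *\<^sub>R y" "(a + b) *\<^sub>R x = a *\<^sub>R x + b *\<^sub>R x"
    "a *\<^sub>R b *\<^sub>R x = (a * b) *\<^sub>R x" "1 *\<^sub>R x = x"
    by (simp_all add: scaleR_l2_def l2.scale_right_distrib l2.scale_left_distrib)
  show "sgn x = inverse (norm x) *\<^sub>R x" by (fact sgn_l2_def)
  show "dist x y = norm (x - y)" by (fact dist_l2_def)
  show "uniformity = (INF e\<in>{0<..}. principal {(x::l2, y). dist x y < e})" by (fact uniformity_l2_def)
  show "open U \<longleftrightarrow> (\<forall>x\<in>U. \<forall>\<^sub>F (x', y) in uniformity. x' = x \<longrightarrow> y \<in> U)" by (fact open_l2_def)
  show "inner x y = inner y x"
    unfolding inner_l2_def by (subst cinner_commute) simp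
  show "inner (x + y) z = inner x z + inner y z"
    by (simp add: inner_l2_def cinner_add_left)
  show "inner (a *\<^sub>R x) y = a * inner x y"
    by (simp add: inner_l2_def scaleR_l2_def cinner_scale_left)
  show "0 \<le> inner x x"
    by (cases x) (simp add: inner_l2_def cinner_self)
  show "inner x x = 0 \<longleftrightarrow> x = 0"
  proof (cases x)
    case (l2_of f)
    then have "inner x x = 0 \<longleftrightarrow> (AE z in circle_measure. f z = 0)"
      by (simp add: inner_l2_def cinner_self square_integrable_def integral_nonneg_eq_0_iff_AE)
    also have "\<dots> \<longleftrightarrow> x = 0"
      using l2_of l2_of_eq_iff[OF _ square_integrable_zero] by (simp add: zero_l2_def)
    finally show ?thesis .
  qed
  show "norm x = sqrt (inner x x)"
    by (simp add: norm_eq_norm_l2 Defs.norm_l2_def inner_l2_def)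
qed

end

lemma prob_circle [simp]: "measure circle_measure (sphere 0 1) = 1"
  using circle.prob_space by simp

lemma norm_l2_of_square:
  assumes "square_integrable f"
  shows "(norm (l2_of f))\<^sup>2 = integral\<^sup>L circle_measure (\<lambda>z. (cmod (f z))\<^sup>2)"
  using cinner_self[OF assms] by (simp add: power2_norm_eq_inner inner_l2_def)

lemma cinner_self_norm: "cinner_l2 x x = of_real ((norm x)\<^sup>2)"
  by (cases x) (simp add: cinner_self norm_l2_of_square)

lemma cinner_zero_left [simp]: "cinner_l2 0 x = 0"
  using cinner_scale_left[of 0 x x] by (simp del: cinner_scale_left)

lemma cinner_eq_zero_commute: "cinner_l2 x y = 0 \<longleftrightarrow> cinner_l2 y x = 0"
  by (subst cinner_commute) simp

lemma cinner_diff_left: "cinner_l2 (x - y) z = cinner_l2 x z - cinner_l2 y z"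
  using cinner_add_left[of "x - y" y z] by simp

lemma cinner_scale_right: "cinner_l2 x (scaleC_l2 c y) = cnj c * cinner_l2 x y"
  by (subst (1 2) cinner_commute) (simp add: cinner_scale_left)

lemma norm_scaleC: "norm (scaleC_l2 c x) = cmod c * norm x"
proof -
  have "of_real ((norm (scaleC_l2 c x))\<^sup>2) = c * cnj c * cinner_l2 x x"
    unfolding cinner_self_norm[symmetric] by (simp add: cinner_scale_left cinner_scale_right)
  also have "\<dots> = of_real ((cmod c * norm x)\<^sup>2)"
    by (simp add: cinner_self_norm complex_norm_square[symmetric] power_mult_distrib)
  finally have "(norm (scaleC_l2 c x))\<^sup>2 = (cmod c * norm x)\<^sup>2"
    by (simp only: of_real_eq_iff)
  then show ?thesis by (simp add: power2_eq_iff_nonneg)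
qed

lemma bounded_linear_scaleC: "bounded_linear (scaleC_l2 c)"
proof (rule bounded_linear_intro)
  show "norm (scaleC_l2 c x) \<le> norm x * cmod c" for x
    by (simp add: norm_scaleC mult.commute)
qed (simp_all add: l2.scale_right_distrib scaleR_l2_def mult.commute)

text \<open>The real Cauchy--Schwarz inequality only bounds the real part; rotating \<open>x\<close> by the phase of
  \<open>cinner_l2 x y\<close> turns the real part into the modulus.\<close>

lemma cmod_cinner_le: "cmod (cinner_l2 x y) \<le> norm x * norm y"
proof -
  define c where "c = cinner_l2 x y"
  have "(cmod c)\<^sup>2 = inner (scaleC_l2 (cnj c) x) y"
    by (simp add: inner_l2_def cinner_scale_left cmod_power2 flip: c_def) (simp add: power2_eq_square)
  also have "\<dots> \<le> norm (scaleC_l2 (cnj c) x) * norm y"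
    by (rule norm_cauchy_schwarz)
  finally have "cmod c * cmod c \<le> cmod c * (norm x * norm y)"
    by (simp add: norm_scaleC power2_eq_square mult.assoc)
  then show ?thesis
    by (cases "c = 0") (auto simp: c_def)
qed

lemma bounded_linear_cinner: "bounded_linear (\<lambda>x. cinner_l2 x y)"
proof (rule bounded_linear_intro)
  show "norm (cinner_l2 x y) \<le> norm x * norm y" for x
    by (rule cmod_cinner_le)
qed (simp_all add: cinner_add_left scaleR_l2_def cinner_scale_left scaleR_conv_of_real)

lemmas tendsto_cinner = bounded_linear.tendsto[OF bounded_linear_cinner]

lemma norm_mult_l2_le:
  assumes "ess_bounded \<phi>" "AE z in circle_measure. cmod (\<phi> z) \<le> C" "C \<ge> 0"
  shows "norm (mult_l2 \<phi> x) \<le> C * norm x"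
proof (cases x)
  case (l2_of f)
  have "(norm (mult_l2 \<phi> x))\<^sup>2 = integral\<^sup>L circle_measure (\<lambda>z. (cmod (\<phi> z * f z))\<^sup>2)"
    using l2_of assms(1) by (simp add: l2_of_mult norm_l2_of_square square_integrable_mult)
  also have "\<dots> \<le> integral\<^sup>L circle_measure (\<lambda>z. C\<^sup>2 * (cmod (f z))\<^sup>2)"
  proof (rule integral_mono_AE)
    show "integrable circle_measure (\<lambda>z. (cmod (\<phi> z * f z))\<^sup>2)"
      "integrable circle_measure (\<lambda>z. C\<^sup>2 * (cmod (f z))\<^sup>2)"
      using square_integrable_mult[OF assms(1) l2_of(1)] l2_of(1) by (auto simp: square_integrable_def)
    show "AE z in circle_measure. (cmod (\<phi> z * f z))\<^sup>2 \<le> C\<^sup>2 * (cmod (f z))\<^sup>2"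
      using assms(2) by eventually_elim
        (auto simp: norm_mult power_mult_distrib intro!: mult_right_mono power_mono)
  qed
  also have "\<dots> = (C * norm x)\<^sup>2"
    using l2_of by (simp add: norm_l2_of_square power_mult_distrib)
  finally show ?thesis
    using assms(3) by (simp add: power2_le_iff_abs_le)
qed

lemma norm_l2_of_le:
  assumes "continuous_on (sphere 0 1) f" "\<And>z. cmod z = 1 \<Longrightarrow> cmod (f z) \<le> C"
  shows "norm (l2_of f) \<le> C"
proof -
  have sq: "square_integrable f"
    using assms(1) continuous_on_circle_ess_bounded ess_bounded_square_integrable by blast
  have "0 \<le> C" using order_trans[OF norm_ge_zero assms(2)[of 1]] by simp
  have "(norm (l2_of f))\<^sup>2 \<le> integral\<^sup>L circle_measure (\<lambda>z. C\<^sup>2)"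
    unfolding norm_l2_of_square[OF sq]
  proof (rule integral_mono)
    show "integrable circle_measure (\<lambda>z. (cmod (f z))\<^sup>2)"
      using sq by (auto simp: square_integrable_def)
  qed (auto intro!: power_mono assms(2))
  then have "(norm (l2_of f))\<^sup>2 \<le> C\<^sup>2"
    by simp
  then show ?thesis using \<open>0 \<le> C\<close> by (simp add: power2_le_iff_abs_le)
qed

lemma ortho_complD: "y \<in> ortho_compl M \<Longrightarrow> x \<in> M \<Longrightarrow> cinner_l2 x y = 0"
  by (auto simp: ortho_compl_def cinner_eq_zero_commute[of x])

lemma mem_ortho_compl_iff: "y \<in> ortho_compl M \<longleftrightarrow> (\<forall>x\<in>M. cinner_l2 x y = 0)"
  by (auto simp: ortho_compl_def cinner_eq_zero_commute[of _ y])

lemma eq_0_if_self_ortho: "cinner_l2 x x = 0 \<Longrightarrow> x = 0"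
  by (simp add: cinner_self_norm)

lemma ortho_compl_add: "x \<in> ortho_compl M \<Longrightarrow> y \<in> ortho_compl M \<Longrightarrow> x + y \<in> ortho_compl M"
  by (simp add: ortho_compl_def cinner_add_left)

lemma ortho_compl_diff: "x \<in> ortho_compl M \<Longrightarrow> y \<in> ortho_compl M \<Longrightarrow> x - y \<in> ortho_compl M"
  by (simp add: ortho_compl_def cinner_diff_left)

lemma ortho_compl_scale: "x \<in> ortho_compl M \<Longrightarrow> scaleC_l2 c x \<in> ortho_compl M"
  by (simp add: ortho_compl_def cinner_scale_left)

lemma ortho_compl_0: "0 \<in> ortho_compl M"
  by (simp add: ortho_compl_def)

lemma ortho_compl_twice: "x \<in> M \<Longrightarrow> x \<in> ortho_compl (ortho_compl M)"
  unfolding mem_ortho_compl_iff[of x] by (auto simp: ortho_compl_def)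

section \<open>Completeness of \<open>L\<^sup>2\<close>\<close>

text \<open>On a probability space the \<open>L\<^sup>1\<close> norm is at most the \<open>L\<^sup>2\<close> norm: apply Cauchy--Schwarz to \<open>\<bar>f\<bar>\<close> and
  the constant \<open>1\<close>.\<close>

lemma integral_cmod_le_norm:
  assumes "square_integrable f"
  shows "integrable circle_measure (\<lambda>z. cmod (f z))"
    and "integral\<^sup>L circle_measure (\<lambda>z. cmod (f z)) \<le> norm (l2_of f)"
proof -
  have one: "square_integrable (\<lambda>z. 1)" by (simp add: square_integrable_def)
  let ?g = "\<lambda>z. complex_of_real (cmod (f z))"
  have [measurable]: "f \<in> borel_measurable circle_measure"
    using assms by (simp add: square_integrable_def)
  have "?g \<in> borel_measurable circle_measure" by measurable
  then have g: "square_integrable ?g"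
    using assms by (simp add: square_integrable_def)
  show "integrable circle_measure (\<lambda>z. cmod (f z))"
    using integrable_norm[OF integrable_mult_cnj[OF g one]] by simp
  have "norm (l2_of ?g) = norm (l2_of f)"
  proof (rule power2_eq_imp_eq)
    show "(norm (l2_of ?g))\<^sup>2 = (norm (l2_of f))\<^sup>2"
      using norm_l2_of_square[OF g] norm_l2_of_square[OF assms] by simp
  qed auto
  moreover have "norm (l2_of (\<lambda>z. 1)) = 1"
    by (rule power2_eq_imp_eq) (use norm_l2_of_square[OF one] in auto)
  ultimately have "cmod (cinner_l2 (l2_of ?g) (l2_of (\<lambda>z. 1))) \<le> norm (l2_of f)"
    using cmod_cinner_le[of "l2_of ?g" "l2_of (\<lambda>z. 1)"] by simp
  then show "integral\<^sup>L circle_measure (\<lambda>z. cmod (f z)) \<le> norm (l2_of f)"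
    by (simp add: cinner_l2_of[OF g one])
qed

text \<open>The Riesz--Fischer argument. Along a subsequence whose increments are at most \<open>2 ^ - k\<close> in norm,
  the increments are summable in \<open>L\<^sup>1\<close>, so the representatives converge almost everywhere; Fatou's lemma
  shows that the pointwise limit is also the limit in norm.\<close>

instance l2 :: banach
proof
  fix X :: "nat \<Rightarrow> l2"
  assume X: "Cauchy X"
  have "\<exists>M. \<forall>m\<ge>M. \<forall>n\<ge>M. norm (X m - X n) < (1/2) ^ k" for k :: nat
    using X unfolding Cauchy_iff by (meson zero_less_power half_gt_zero zero_less_one)
  then obtain M where M: "\<And>k m n. m \<ge> M k \<Longrightarrow> n \<ge> M k \<Longrightarrow> norm (X m - X n) < (1/2) ^ k"
    by metis
  \<comment> \<open>the partial sums dominate \<open>M\<close>, and the summand \<open>k\<close> makes \<open>r\<close> strictly increasing\<close>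
  define r where "r k = (\<Sum>i\<le>k. M i) + k" for k
  have r: "strict_mono r"
    unfolding strict_mono_Suc_iff by (simp add: r_def)
  have rM: "M k \<le> r k" for k
    using member_le_sum[of k "{..k}" M] by (simp add: r_def)
  have "\<exists>f. square_integrable f \<and> X (r k) = l2_of f" for k
    by (metis l2_of_cases)
  then obtain f where f: "\<And>k. square_integrable (f k)" and Xf: "\<And>k. X (r k) = l2_of (f k)"
    by metis
  have f_meas [measurable]: "f k \<in> borel_measurable circle_measure" for k
    using f[of k] by (simp add: square_integrable_def)
  define d where "d k z = cmod (f (Suc k) z - f k z)" for k z
  have d_meas [measurable]: "d k \<in> borel_measurable circle_measure" for k
    unfolding d_def by measurable
  have d_int: "integrable circle_measure (d k)" "integral\<^sup>L circle_measure (d k) \<le> (1/2) ^ k" for k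
  proof -
    note sq = square_integrable_diff[OF f[of "Suc k"] f[of k]]
    show "integrable circle_measure (d k)"
      unfolding d_def by (rule integral_cmod_le_norm(1)[OF sq])
    have "norm (X (r (Suc k)) - X (r k)) < (1/2) ^ k"
      using rM[of k] strict_monoD[OF r, of k "Suc k"] by (intro M) auto
    then show "integral\<^sup>L circle_measure (d k) \<le> (1/2) ^ k"
      using integral_cmod_le_norm(2)[OF sq] unfolding d_def by (simp add: Xf l2_of_diff f)
  qed
  have "(\<integral>\<^sup>+z. (\<Sum>k. ennreal (d k z)) \<partial>circle_measure) = (\<Sum>k. \<integral>\<^sup>+z. ennreal (d k z) \<partial>circle_measure)"
    by (rule nn_integral_suminf) measurable
  also have "\<dots> \<le> (\<Sum>k. ennreal ((1/2) ^ k))"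
  proof (intro suminf_le allI)
    show "(\<integral>\<^sup>+z. ennreal (d k z) \<partial>circle_measure) \<le> ennreal ((1/2) ^ k)" for k
      using d_int by (subst nn_integral_eq_integral) (auto simp: d_def intro: ennreal_leI)
  qed auto
  also have "\<dots> < top"
  proof -
    have "summable (\<lambda>k. (1/2::real) ^ k)"
      by (intro summable_geometric) auto
    then have "(\<Sum>k. ennreal ((1/2) ^ k)) \<noteq> top"
      by (rule ennreal_suminf_neq_top) auto
    then show ?thesis unfolding less_top .
  qed
  finally have "AE z in circle_measure. (\<Sum>k. ennreal (d k z)) \<noteq> \<infinity>"
    by (intro nn_integral_PInf_AE) auto
  then have conv: "AE z in circle_measure. convergent (\<lambda>k. f k z)"
  proof eventually_elim
    case (elim z)
    then have "summable (\<lambda>k. norm (f (Suc k) z - f k z))"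
      using summable_suminf_not_top[of "\<lambda>k. d k z"] by (simp add: d_def)
    then have "summable (\<lambda>k. f (Suc k) z - f k z)"
      by (rule summable_norm_cancel)
    then have "convergent (\<lambda>k. \<Sum>i<k. f (Suc i) z - f i z)"
      by (simp add: summable_iff_convergent)
    then have "convergent (\<lambda>k. f k z - f 0 z)"
      unfolding sum_lessThan_telescope[of "\<lambda>k. f k z"] .
    then show ?case
      by (simp add: convergent_diff_const_right_iff)
  qed
  define g where "g z = lim (\<lambda>k. f k z)" for z
  have g_meas [measurable]: "g \<in> borel_measurable circle_measure"
    unfolding g_def by measurable
  have fatou: "(\<integral>\<^sup>+z. ennreal ((cmod (g z - f k z))\<^sup>2) \<partial>circle_measure) \<le> ennreal (e\<^sup>2)"
    if e: "\<And>j. j \<ge> K \<Longrightarrow> norm (X (r j) - X (r k)) \<le> e" for k e K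
  proof -
    have "(\<integral>\<^sup>+z. ennreal ((cmod (g z - f k z))\<^sup>2) \<partial>circle_measure)
        = (\<integral>\<^sup>+z. liminf (\<lambda>j. ennreal ((cmod (f j z - f k z))\<^sup>2)) \<partial>circle_measure)"
    proof (rule nn_integral_cong_AE, use conv in eventually_elim)
      case (elim z)
      then have "(\<lambda>j. f j z) \<longlonglongrightarrow> g z"
        by (simp add: g_def convergent_LIMSEQ_iff)
      then have "(\<lambda>j. ennreal ((cmod (f j z - f k z))\<^sup>2)) \<longlonglongrightarrow> ennreal ((cmod (g z - f k z))\<^sup>2)"
        by (intro tendsto_intros tendsto_ennrealI)
      from lim_imp_Liminf[OF sequentially_bot this] show ?case
        by (rule sym)
    qed
    also have "\<dots> \<le> liminf (\<lambda>j. \<integral>\<^sup>+z. ennreal ((cmod (f j z - f k z))\<^sup>2) \<partial>circle_measure)"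
      by (rule nn_integral_liminf) measurable
    also have "\<dots> \<le> liminf (\<lambda>j. ennreal (e\<^sup>2))"
    proof (rule Liminf_mono)
      have "(\<integral>\<^sup>+z. ennreal ((cmod (f j z - f k z))\<^sup>2) \<partial>circle_measure) \<le> ennreal (e\<^sup>2)" if "j \<ge> K" for j
      proof -
        note sq = square_integrable_diff[OF f[of j] f[of k]]
        have "(\<integral>\<^sup>+z. ennreal ((cmod (f j z - f k z))\<^sup>2) \<partial>circle_measure)
            = ennreal ((norm (X (r j) - X (r k)))\<^sup>2)"
          using sq unfolding Xf l2_of_diff[OF f f] norm_l2_of_square[OF sq]
          by (intro nn_integral_eq_integral) (auto simp: square_integrable_def)
        also have "\<dots> \<le> ennreal (e\<^sup>2)"
          using e[OF that] by (intro ennreal_leI power_mono) auto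
        finally show ?thesis .
      qed
      then show "\<forall>\<^sub>F j in sequentially.
          (\<integral>\<^sup>+z. ennreal ((cmod (f j z - f k z))\<^sup>2) \<partial>circle_measure) \<le> ennreal (e\<^sup>2)"
        by (auto simp: eventually_sequentially)
    qed
    finally show ?thesis by (simp add: Liminf_const)
  qed
  have Xr: "Cauchy (X \<circ> r)"
    using X r by (rule Cauchy_subseq_Cauchy)
  have sq_diff: "square_integrable (\<lambda>z. g z - f k z) \<and> norm (l2_of (\<lambda>z. g z - f k z)) \<le> e"
    if e: "\<And>j. j \<ge> K \<Longrightarrow> norm (X (r j) - X (r k)) \<le> e" for k e K
  proof -
    have "0 \<le> e" using e[of K] norm_ge_zero order_trans by blast
    have sq: "square_integrable (\<lambda>z. g z - f k z)"
      unfolding square_integrable_def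
    proof (intro conjI integrableI_bounded)
      show "(\<integral>\<^sup>+z. ennreal (norm ((cmod (g z - f k z))\<^sup>2)) \<partial>circle_measure) < \<infinity>"
        using le_less_trans[OF fatou[OF e] ennreal_less_top] by simp
    qed measurable
    moreover have "(norm (l2_of (\<lambda>z. g z - f k z)))\<^sup>2 \<le> e\<^sup>2"
      using fatou[OF e] sq unfolding norm_l2_of_square[OF sq]
      by (subst (asm) nn_integral_eq_integral) (auto simp: square_integrable_def)
    ultimately show ?thesis
      using \<open>0 \<le> e\<close> by (simp add: power2_le_iff_abs_le)
  qed
  have near: "\<exists>K. \<forall>j\<ge>K. \<forall>k\<ge>K. norm (X (r j) - X (r k)) \<le> e" if "e > 0" for e
    using Xr that unfolding Cauchy_iff o_def by (meson less_imp_le)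
  obtain K where K: "\<And>j. j \<ge> K \<Longrightarrow> norm (X (r j) - X (r K)) \<le> 1"
    using near[of 1] by auto
  have sq_g: "square_integrable g"
    using square_integrable_add[OF conjunct1[OF sq_diff[OF K]] f[of K]] by simp
  have "(X \<circ> r) \<longlonglongrightarrow> l2_of g"
  proof (rule LIMSEQ_I)
    fix e :: real assume "e > 0"
    then obtain K where K: "\<And>j k. j \<ge> K \<Longrightarrow> k \<ge> K \<Longrightarrow> norm (X (r j) - X (r k)) \<le> e / 2"
      using near[of "e / 2"] by auto
    have "norm (X (r k) - l2_of g) < e" if "k \<ge> K" for k
    proof -
      have "norm (l2_of g - X (r k)) \<le> e / 2"
        using sq_diff[of K k "e / 2"] K that by (simp add: Xf l2_of_diff sq_g f)
      then show ?thesis using \<open>e > 0\<close> by (simp add: norm_minus_commute)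
    qed
    then show "\<exists>K. \<forall>k\<ge>K. norm ((X \<circ> r) k - l2_of g) < e" by auto
  qed
  then show "convergent X"
    using Cauchy_converges_subseq[OF X r] convergentI by blast
qed

section \<open>Monomials and Fourier coefficients\<close>

lemma continuous_on_circle_square_integrable:
  "continuous_on (sphere 0 1) f \<Longrightarrow> square_integrable f"
  by (intro ess_bounded_square_integrable continuous_on_circle_ess_bounded)

definition zpow :: "nat \<Rightarrow> l2" where
  "zpow n = l2_of (\<lambda>z. z ^ n)"

lemma square_integrable_power: "square_integrable (\<lambda>z. z ^ n)"
  by (intro continuous_on_circle_square_integrable continuous_intros)

lemma cinner_zpow: "cinner_l2 (zpow m) (zpow n) = (if m = n then 1 else 0)"
proof -
  have unit: "z ^ n * cnj (z ^ n) = 1" if "z \<in> sphere 0 1" for z :: complex and n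
    using that
    unfolding complex_cnj_power power_mult_distrib[symmetric] complex_norm_square[symmetric]
    by simp
  have ord: "cinner_l2 (zpow m) (zpow n) = 0" if "n < m" for m n
  proof -
    have "cinner_l2 (zpow m) (zpow n) = integral\<^sup>L circle_measure (\<lambda>z. z ^ m * cnj (z ^ n))"
      unfolding zpow_def by (rule cinner_l2_of) (rule square_integrable_power)+
    also have "\<dots> = integral\<^sup>L circle_measure (\<lambda>z. z ^ (m - n))"
    proof (rule Bochner_Integration.integral_cong)
      fix z assume "z \<in> space circle_measure"
      then have "z ^ (m - n) * (z ^ n * cnj (z ^ n)) = z ^ (m - n)"
        using unit[of z n] by simp
      moreover have "z ^ (m - n) * z ^ n = z ^ m"
        using that by (simp flip: power_add)
      ultimately show "z ^ m * cnj (z ^ n) = z ^ (m - n)"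
        by (metis mult.assoc)
    qed simp
    also have "\<dots> = 0"
      using that by (intro integral_circle_power) auto
    finally show ?thesis .
  qed
  show ?thesis
  proof (cases m n rule: linorder_cases)
    case equal
    have "cinner_l2 (zpow m) (zpow m) = integral\<^sup>L circle_measure (\<lambda>z. z ^ m * cnj (z ^ m))"
      unfolding zpow_def by (rule cinner_l2_of) (rule square_integrable_power)+
    also have "\<dots> = integral\<^sup>L circle_measure (\<lambda>z. 1)"
      by (rule Bochner_Integration.integral_cong) (use unit in auto)
    finally show ?thesis using equal by simp
  next
    case less
    then show ?thesis
      using ord[of m n] by (simp add: cinner_eq_zero_commute[of "zpow m"])
  next
    case greater
    then show ?thesis by (simp add: ord)
  qed
qed

definition coef :: "l2 \<Rightarrow> nat \<Rightarrow> complex" where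
  "coef x n = cinner_l2 x (zpow n)"

abbreviation zpoly :: "(nat \<Rightarrow> complex) \<Rightarrow> nat \<Rightarrow> l2" where
  "zpoly b N \<equiv> (\<Sum>n<N. scaleC_l2 (b n) (zpow n))"

lemma coef_zpoly: "coef (zpoly b N) m = (if m < N then b m else 0)"
  by (induction N) (auto simp: coef_def cinner_add_left cinner_scale_left cinner_zpow less_Suc_eq)

lemma cinner_zpoly_eq_0:
  assumes "\<And>n. n < N \<Longrightarrow> coef y n = 0"
  shows "cinner_l2 (zpoly b N) y = 0"
  using assms
proof (induction N)
  case (Suc N)
  then have "cinner_l2 (zpow N) y = 0"
    by (simp add: coef_def cinner_eq_zero_commute[of y])
  with Suc show ?case by (simp add: cinner_add_left cinner_scale_left)
qed simp

lemma norm_zpoly: "(norm (zpoly b N))\<^sup>2 = (\<Sum>n<N. (cmod (b n))\<^sup>2)"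
proof (induction N)
  case (Suc N)
  have "cinner_l2 (zpoly b N) (zpow N) = 0"
    using coef_zpoly[of b N N] by (simp add: coef_def)
  then have "orthogonal (zpoly b N) (scaleC_l2 (b N) (zpow N))"
    by (simp add: orthogonal_def inner_l2_def cinner_scale_right)
  moreover have "(norm (zpow N))\<^sup>2 = 1"
    using cinner_self_norm[of "zpow N"] by (simp add: cinner_zpow flip: of_real_eq_iff[where 'a = complex])
  ultimately show ?case
    using Suc by (simp add: norm_add_Pythagorean norm_scaleC power_mult_distrib)
qed simp

lemma bessel: "(\<Sum>n<N. (cmod (coef x n))\<^sup>2) \<le> (norm x)\<^sup>2"
proof -
  let ?p = "zpoly (coef x) N"
  have "coef (x - ?p) n = 0" if "n < N" for n
    using that coef_zpoly[of "coef x" N n] by (simp add: coef_def cinner_diff_left)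
  then have "cinner_l2 ?p (x - ?p) = 0"
    by (rule cinner_zpoly_eq_0)
  then have "orthogonal ?p (x - ?p)"
    by (simp add: orthogonal_def inner_l2_def)
  then have "(norm x)\<^sup>2 = (norm ?p)\<^sup>2 + (norm (x - ?p))\<^sup>2"
    using norm_add_Pythagorean[of ?p "x - ?p"] by simp
  then show ?thesis by (simp add: norm_zpoly)
qed

lemma summable_coef: "summable (\<lambda>n. (cmod (coef x n))\<^sup>2)"
  by (rule summableI_nonneg_bounded[OF _ bessel]) simp

text \<open>Square summable coefficients cannot grow geometrically. This makes the kernels trivial for \<open>l\<close>
  on the circle and outside the disk.\<close>

lemma coef_eq_0_if_geometric:
  assumes "cmod \<mu> \<ge> 1" "\<And>n. coef x (Suc n) = \<mu> * coef x n"
  shows "coef x n = 0"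
proof -
  have pow: "coef x n = \<mu> ^ n * coef x 0" for n
    by (induction n) (simp_all add: assms(2) mult_ac)
  have ge: "(cmod (coef x 0))\<^sup>2 \<le> (cmod (coef x n))\<^sup>2" for n
    using one_le_power[OF assms(1), of n] unfolding pow[of n]
    by (intro power_mono) (auto simp: norm_mult norm_power mult_le_cancel_right1)
  have "(\<lambda>n. (cmod (coef x n))\<^sup>2) \<longlonglongrightarrow> 0"
    by (rule summable_LIMSEQ_zero[OF summable_coef])
  then have "(cmod (coef x 0))\<^sup>2 \<le> 0"
    by (rule LIMSEQ_le_const) (use ge in auto)
  then show ?thesis using pow[of n] by simp
qed

lemma parseval_sums:
  assumes "(\<lambda>n. scaleC_l2 (b n) (zpow n)) sums x"
  shows "(\<lambda>n. (cmod (b n))\<^sup>2) sums (norm x)\<^sup>2"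
proof -
  have "(\<lambda>N. (norm (zpoly b N))\<^sup>2) \<longlonglongrightarrow> (norm x)\<^sup>2"
    using assms unfolding sums_def by (intro tendsto_intros)
  then show ?thesis unfolding sums_def norm_zpoly .
qed

lemma coef_sums:
  assumes "(\<lambda>n. scaleC_l2 (b n) (zpow n)) sums x"
  shows "coef x m = b m"
proof -
  have "(\<lambda>N. coef (zpoly b N) m) \<longlonglongrightarrow> coef x m"
    using assms unfolding sums_def coef_def by (rule tendsto_cinner)
  moreover have "\<forall>\<^sub>F N in sequentially. coef (zpoly b N) m = b m"
    using eventually_gt_at_top[of m] by eventually_elim (simp add: coef_zpoly)
  then have "(\<lambda>N. coef (zpoly b N) m) \<longlonglongrightarrow> b m"
    by (rule tendsto_eventually)
  ultimately show ?thesis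
    by (rule LIMSEQ_unique)
qed

lemma zpoly_eq_l2_of: "zpoly b N = l2_of (\<lambda>z. \<Sum>n<N. b n * z ^ n)"
proof (induction N)
  case (Suc N)
  have "square_integrable (\<lambda>z. \<Sum>n<N. b n * z ^ n)"
    by (intro continuous_on_circle_square_integrable continuous_intros)
  with Suc show ?case
    by (simp only: sum.lessThan_Suc zpow_def l2_of_scaleC[OF square_integrable_power]
        l2_of_add[OF _ square_integrable_scale[OF square_integrable_power]])
qed (simp add: zero_l2_def)

text \<open>An absolutely convergent series converges uniformly on the circle, hence in \<open>L\<^sup>2\<close>.\<close>

lemma zpow_sums_l2_of:
  assumes F: "\<And>z. cmod z = 1 \<Longrightarrow> (\<lambda>n. b n * z ^ n) sums F z"
    and cont: "continuous_on (sphere 0 1) F"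
    and b: "summable (\<lambda>n. cmod (b n))"
  shows "(\<lambda>n. scaleC_l2 (b n) (zpow n)) sums l2_of F"
  unfolding sums_def
proof (rule LIMSEQ_I)
  fix e :: real assume "e > 0"
  then obtain N where N: "\<And>n. n \<ge> N \<Longrightarrow> norm (\<Sum>i. cmod (b (i + n))) < e"
    using suminf_exist_split[OF _ b] by blast
  have "norm (zpoly b n - l2_of F) < e" if "n \<ge> N" for n
  proof -
    have poly_cont: "continuous_on (sphere 0 1) (\<lambda>z. \<Sum>i<n. b i * z ^ i)"
      by (intro continuous_intros)
    have "zpoly b n - l2_of F = l2_of (\<lambda>z. (\<Sum>i<n. b i * z ^ i) - F z)"
      unfolding zpoly_eq_l2_of
      by (intro l2_of_diff continuous_on_circle_square_integrable cont poly_cont)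
    also have "norm \<dots> \<le> (\<Sum>i. cmod (b (i + n)))"
    proof (rule norm_l2_of_le)
      show "continuous_on (sphere 0 1) (\<lambda>z. (\<Sum>i<n. b i * z ^ i) - F z)"
        by (intro continuous_on_diff poly_cont cont)
      fix z :: complex assume z: "cmod z = 1"
      have norm_eq: "cmod (b i * z ^ i) = cmod (b i)" for i
        using z by (simp add: norm_mult norm_power)
      have "F z = (\<Sum>i. b (i + n) * z ^ (i + n)) + (\<Sum>i<n. b i * z ^ i)"
        using F[OF z] suminf_split_initial_segment[of "\<lambda>i. b i * z ^ i" n]
        by (simp add: sums_iff)
      then have "cmod ((\<Sum>i<n. b i * z ^ i) - F z) = cmod (\<Sum>i. b (i + n) * z ^ (i + n))"
        by simp
      also have "\<dots> \<le> (\<Sum>i. cmod (b (i + n) * z ^ (i + n)))"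
        using summable_ignore_initial_segment[OF b, of n] by (intro summable_norm) (simp add: norm_eq)
      finally show "cmod ((\<Sum>i<n. b i * z ^ i) - F z) \<le> (\<Sum>i. cmod (b (i + n)))"
        by (simp add: norm_eq)
    qed
    also have "\<dots> < e"
      using N[OF that] by simp
    finally show ?thesis .
  qed
  then show "\<exists>N. \<forall>n\<ge>N. norm (zpoly b n - l2_of F) < e" by blast
qed

text \<open>By orthonormality the partial sums form a Cauchy sequence; completeness of \<open>L\<^sup>2\<close> enters here.\<close>

lemma summable_zpow:
  assumes "summable (\<lambda>n. (cmod (b n))\<^sup>2)"
  shows "summable (\<lambda>n. scaleC_l2 (b n) (zpow n))"
proof -
  have block: "(norm (\<Sum>n\<in>{m..<k}. scaleC_l2 (b n) (zpow n)))\<^sup>2 = (\<Sum>n\<in>{m..<k}. (cmod (b n))\<^sup>2)" for m k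
  proof -
    have "(\<Sum>n\<in>{m..<k}. scaleC_l2 (b n) (zpow n)) = zpoly (\<lambda>n. if m \<le> n then b n else 0) k"
      by (rule sum.mono_neutral_cong_left) auto
    moreover have "(\<Sum>n\<in>{m..<k}. (cmod (b n))\<^sup>2) = (\<Sum>n<k. (cmod (if m \<le> n then b n else 0))\<^sup>2)"
      by (rule sum.mono_neutral_cong_left) auto
    ultimately show ?thesis by (simp only: norm_zpoly)
  qed
  show ?thesis
    unfolding summable_Cauchy
  proof (intro allI impI)
    fix e :: real assume "e > 0"
    then obtain N where N: "\<And>m k. m \<ge> N \<Longrightarrow> norm (\<Sum>n\<in>{m..<k}. (cmod (b n))\<^sup>2) < e\<^sup>2"
      using assms unfolding summable_Cauchy by (meson zero_less_power)
    have "norm (\<Sum>n\<in>{m..<k}. scaleC_l2 (b n) (zpow n)) < e" if "m \<ge> N" for m k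
    proof (rule power_less_imp_less_base)
      show "(norm (\<Sum>n\<in>{m..<k}. scaleC_l2 (b n) (zpow n)))\<^sup>2 < e\<^sup>2"
        using N[OF that, of k] unfolding block by simp
    qed (use \<open>e > 0\<close> in simp)
    then show "\<exists>N. \<forall>m\<ge>N. \<forall>k. norm (\<Sum>n\<in>{m..<k}. scaleC_l2 (b n) (zpow n)) < e"
      by blast
  qed
qed

section \<open>The Hardy space\<close>

definition dilation :: "(complex \<Rightarrow> complex) \<Rightarrow> real \<Rightarrow> l2" where
  "dilation F r = l2_of (\<lambda>z. F (of_real r * z))"

text \<open>The predicate keeps track of the function in the disk that an element of \<open>H2\<close> comes from, so that
  values at the origin can be read off after multiplications.\<close>

definition h2_boundary :: "(complex \<Rightarrow> complex) \<Rightarrow> l2 \<Rightarrow> bool" where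
  "h2_boundary F x \<longleftrightarrow> F \<in> hardy_disk \<and> (dilation F \<longlongrightarrow> x) (at_left 1)"

lemma mem_H2_iff: "x \<in> H2 \<longleftrightarrow> (\<exists>F. h2_boundary F x)"
  unfolding H2_def h2_boundary_def dilation_def Lim_null[of _ x]
  by (auto simp: norm_eq_norm_l2[symmetric] tendsto_norm_zero_iff Bex_def)

lemma eventually_at_left_1: "\<forall>\<^sub>F r in at_left (1::real). 0 < r \<and> r < 1"
  using eventually_at_left_real[of 0 1] by (auto elim: eventually_mono)

lemma continuous_on_dilation:
  assumes "F holomorphic_on ball 0 1" "0 \<le> r" "r < 1"
  shows "continuous_on (sphere 0 1) (\<lambda>z. F (of_real r * z))"
proof (rule continuous_on_compose2[OF holomorphic_on_imp_continuous_on[OF assms(1)]])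
  show "(*) (complex_of_real r) ` sphere 0 1 \<subseteq> ball 0 1"
    using assms by (auto simp: norm_mult)
qed (intro continuous_intros)

lemma hardy_disk_iff:
  "F \<in> hardy_disk \<longleftrightarrow> F holomorphic_on ball 0 1 \<and>
     (\<exists>C. \<forall>r. 0 \<le> r \<and> r < 1 \<longrightarrow> norm (dilation F r) \<le> C)"
proof (cases "F holomorphic_on ball 0 1")
  case True
  have sq: "(norm (dilation F r))\<^sup>2 = integral\<^sup>L circle_measure (\<lambda>z. (cmod (F (of_real r * z)))\<^sup>2)"
    if "0 \<le> r" "r < 1" for r
    unfolding dilation_def
    by (intro norm_l2_of_square continuous_on_circle_square_integrable continuous_on_dilation True that)
  have "(\<exists>C. \<forall>r. 0 \<le> r \<and> r < 1 \<longrightarrow> norm (dilation F r) \<le> C) \<longleftrightarrow>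
      (\<exists>C. \<forall>r. 0 \<le> r \<and> r < 1 \<longrightarrow> (norm (dilation F r))\<^sup>2 \<le> C)" (is "?A \<longleftrightarrow> ?B")
  proof
    assume ?A
    then obtain C where "\<forall>r. 0 \<le> r \<and> r < 1 \<longrightarrow> norm (dilation F r) \<le> C" by blast
    then show ?B by (intro exI[of _ "C\<^sup>2"]) (auto intro!: power_mono)
  next
    assume ?B
    then obtain C where "\<forall>r. 0 \<le> r \<and> r < 1 \<longrightarrow> (norm (dilation F r))\<^sup>2 \<le> C" by blast
    then show ?A by (intro exI[of _ "sqrt C"]) (auto intro!: real_le_rsqrt)
  qed
  then show ?thesis
    using True sq by (auto simp: hardy_disk_def)
qed (simp add: hardy_disk_def)

lemma dilation_sums:
  assumes F: "\<And>w. w \<in> ball 0 1 \<Longrightarrow> (\<lambda>n. a n * w ^ n) sums F w" and r: "0 \<le> r" "r < 1"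
  shows "(\<lambda>n. scaleC_l2 (a n * of_real r ^ n) (zpow n)) sums dilation F r"
  unfolding dilation_def
proof (rule zpow_sums_l2_of)
  have hol: "F holomorphic_on ball 0 1"
    by (rule power_series_holomorphic[of 0 1 a]) (use F in auto)
  show "continuous_on (sphere 0 1) (\<lambda>z. F (of_real r * z))"
    by (rule continuous_on_dilation[OF hol r])
  show "(\<lambda>n. a n * of_real r ^ n * z ^ n) sums F (of_real r * z)" if "cmod z = 1" for z
    using F[of "of_real r * z"] that r by (simp add: norm_mult power_mult_distrib mult_ac)
  obtain s where s: "r < s" "s < 1" using r dense by blast
  have "summable (\<lambda>n. a n * of_real s ^ n)"
    using F[of "of_real s"] r s by (simp add: sums_iff)
  then show "summable (\<lambda>n. cmod (a n * of_real r ^ n))"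
    by (rule powser_insidea) (use r s in auto)
qed

lemma holomorphic_taylor_sums:
  assumes "F holomorphic_on ball 0 1"
  shows "\<exists>a. \<forall>w\<in>ball 0 1. (\<lambda>n. a n * w ^ n) sums F w"
  using holomorphic_power_series[OF assms]
  by (intro exI[of _ "\<lambda>n. (deriv ^^ n) F 0 / fact n"]) simp

lemma coef_h2_boundary:
  assumes "h2_boundary F x" and a: "\<And>w. w \<in> ball 0 1 \<Longrightarrow> (\<lambda>n. a n * w ^ n) sums F w"
  shows "coef x n = a n"
proof -
  have "((\<lambda>r. coef (dilation F r) n) \<longlongrightarrow> coef x n) (at_left 1)"
    using assms(1) unfolding h2_boundary_def coef_def by (blast intro: tendsto_cinner)
  moreover have "\<forall>\<^sub>F r in at_left 1. coef (dilation F r) n = a n * of_real r ^ n"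
    using eventually_at_left_1 by eventually_elim (auto intro: coef_sums[OF dilation_sums[OF a]])
  ultimately have "((\<lambda>r. a n * of_real r ^ n) \<longlongrightarrow> coef x n) (at_left (1::real))"
    using tendsto_cong by force
  moreover have "((\<lambda>r. a n * of_real r ^ n) \<longlongrightarrow> a n * of_real 1 ^ n) (at_left (1::real))"
    by (intro tendsto_intros)
  ultimately show ?thesis
    using tendsto_unique[OF trivial_limit_at_left_real] by fastforce
qed

lemma coef_0_h2_boundary:
  assumes "h2_boundary F x"
  shows "coef x 0 = F 0"
proof -
  have "F holomorphic_on ball 0 1"
    using assms by (simp add: h2_boundary_def hardy_disk_def)
  then obtain a where a: "\<And>w. w \<in> ball 0 1 \<Longrightarrow> (\<lambda>n. a n * w ^ n) sums F w"
    using holomorphic_taylor_sums by blast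
  have "F 0 = a 0"
    by (rule sums_unique2[OF a powser_sums_zero]) simp
  then show ?thesis
    using coef_h2_boundary[OF assms a] by simp
qed

text \<open>Each dilation is an \<open>L\<^sup>2\<close>-convergent series of monomials, and every element of \<open>H2\<close> is a limit of
  dilations.\<close>

lemma ortho_H2_if_coef_eq_0:
  assumes "\<And>n. coef y n = 0"
  shows "y \<in> ortho_compl H2"
proof -
  have "cinner_l2 x y = 0" if F: "h2_boundary F x" for F x
  proof -
    have "F holomorphic_on ball 0 1"
      using F by (simp add: h2_boundary_def hardy_disk_def)
    then obtain a where a: "\<And>w. w \<in> ball 0 1 \<Longrightarrow> (\<lambda>n. a n * w ^ n) sums F w"
      using holomorphic_taylor_sums by blast
    have "cinner_l2 (dilation F r) y = 0" if "0 < r" "r < 1" for r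
    proof -
      have "(\<lambda>N. cinner_l2 (zpoly (\<lambda>n. a n * of_real r ^ n) N) y) \<longlonglongrightarrow> cinner_l2 (dilation F r) y"
        using dilation_sums[OF a, of r] that unfolding sums_def by (intro tendsto_cinner) auto
      then show ?thesis
        by (simp add: cinner_zpoly_eq_0 assms LIMSEQ_const_iff)
    qed
    then have "\<forall>\<^sub>F r in at_left 1. cinner_l2 (dilation F r) y = 0"
      by (auto intro: eventually_mono[OF eventually_at_left_1])
    moreover have "((\<lambda>r. cinner_l2 (dilation F r) y) \<longlongrightarrow> cinner_l2 x y) (at_left 1)"
      using F unfolding h2_boundary_def by (blast intro: tendsto_cinner)
    ultimately have "((\<lambda>r. 0) \<longlongrightarrow> cinner_l2 x y) (at_left (1::real))"
      using tendsto_cong by force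
    then show ?thesis
      by (simp add: tendsto_const_iff)
  qed
  then show ?thesis
    by (auto simp: ortho_compl_def mem_H2_iff cinner_eq_zero_commute[of y])
qed

text \<open>With \<open>F\<close> given by the coefficients \<open>a n\<close>, Parseval turns the squared distance from the dilation
  \<open>F (r z)\<close> to \<open>x\<close> into the series of \<open>\<bar>a n\<bar>\<^sup>2 (1 - r ^ n)\<^sup>2\<close>. It is dominated by the convergent series of
  \<open>\<bar>a n\<bar>\<^sup>2\<close>, so it is continuous in \<open>r\<close> up to \<open>1\<close>, where it vanishes.\<close>

lemma h2_boundary_power_series:
  assumes F: "\<And>w. w \<in> ball 0 1 \<Longrightarrow> (\<lambda>n. a n * w ^ n) sums F w"
    and x: "(\<lambda>n. scaleC_l2 (a n) (zpow n)) sums x"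
  shows "h2_boundary F x"
proof -
  have sq: "summable (\<lambda>n. (cmod (a n))\<^sup>2)"
    using parseval_sums[OF x] by (simp add: sums_iff)
  have pow_le: "1 - r ^ n \<le> 1" "0 \<le> 1 - r ^ n" if "r \<in> {0..1}" for r :: real and n
    using that by (auto simp: power_le_one)
  define h where "h r = (\<Sum>n. (cmod (a n))\<^sup>2 * (1 - r ^ n)\<^sup>2)" for r :: real
  have "uniform_limit {0..1} (\<lambda>N r. \<Sum>n<N. (cmod (a n))\<^sup>2 * (1 - r ^ n)\<^sup>2) h sequentially"
    unfolding h_def
    by (rule Weierstrass_m_test[OF _ sq])
      (use pow_le in \<open>auto intro!: mult_left_le power_le_one\<close>)
  then have "continuous_on {0..1} h"
    by (rule uniform_limit_theorem[rotated]) (auto intro!: continuous_intros always_eventually)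
  then have "(h \<longlongrightarrow> h 1) (at_left 1)"
    by (auto simp: continuous_on_def at_within_Icc_at_left dest: bspec[of _ _ 1])
  then have h: "(h \<longlongrightarrow> 0) (at_left 1)"
    by (simp add: h_def)
  have diff: "(norm (dilation F r - x))\<^sup>2 = h r" if r: "0 \<le> r" "r < 1" for r
  proof -
    have "(\<lambda>n. scaleC_l2 (a n * of_real r ^ n - a n) (zpow n)) sums (dilation F r - x)"
      using sums_diff[OF dilation_sums[OF F r] x] by (simp add: l2.scale_left_diff_distrib)
    from sums_unique[OF parseval_sums[OF this]]
    have "(norm (dilation F r - x))\<^sup>2 = (\<Sum>n. (cmod (a n * of_real r ^ n - a n))\<^sup>2)" .
    moreover have "(cmod (a n * of_real r ^ n - a n))\<^sup>2 = (cmod (a n))\<^sup>2 * (1 - r ^ n)\<^sup>2" for n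
    proof -
      have "a n * of_real r ^ n - a n = a n * of_real (r ^ n - 1)"
        by (simp add: algebra_simps)
      then have "(cmod (a n * of_real r ^ n - a n))\<^sup>2 = (cmod (a n))\<^sup>2 * (r ^ n - 1)\<^sup>2"
        by (simp only: norm_mult norm_of_real power_mult_distrib power2_abs)
      then show ?thesis by (simp add: power2_commute)
    qed
    ultimately show ?thesis by (simp add: h_def)
  qed
  have "((\<lambda>r. (norm (dilation F r - x))\<^sup>2) \<longlongrightarrow> 0) (at_left 1)"
    using h by (rule Lim_transform_eventually)
      (use diff in \<open>auto intro!: eventually_mono[OF eventually_at_left_1]\<close>)
  from tendsto_real_sqrt[OF this] have "((\<lambda>r. norm (dilation F r - x)) \<longlongrightarrow> 0) (at_left 1)"
    by simp
  then have lim: "(dilation F \<longlongrightarrow> x) (at_left 1)"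
    by (simp add: Lim_null[of _ x] tendsto_norm_zero_iff)
  have "norm (dilation F r) \<le> norm x" if r: "0 \<le> r" "r < 1" for r
  proof (rule power2_le_imp_le)
    have "(cmod (a n * of_real r ^ n))\<^sup>2 \<le> (cmod (a n))\<^sup>2" for n
      using r by (intro power_mono) (auto simp: norm_mult norm_power intro!: mult_left_le power_le_one)
    then show "(norm (dilation F r))\<^sup>2 \<le> (norm x)\<^sup>2"
      by (rule sums_le[OF _ parseval_sums[OF dilation_sums[OF F r]] parseval_sums[OF x]])
  qed simp
  moreover have "F holomorphic_on ball 0 1"
    by (rule power_series_holomorphic[of 0 1 a]) (use F in auto)
  ultimately show ?thesis
    using lim by (auto simp: h2_boundary_def hardy_disk_iff)
qed

text \<open>The coefficients with nonnegative index define a function in the disk that belongs to \<open>H2\<close>, and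
  the remainder has none of them left.\<close>

lemma analytic_part:
  assumes "(\<lambda>n. scaleC_l2 (coef x n) (zpow n)) sums g"
  shows "g \<in> H2" "x - g \<in> ortho_compl H2"
proof -
  have le: "cmod (coef x n) \<le> norm x" for n
  proof (rule power2_le_imp_le)
    have "(cmod (coef x n))\<^sup>2 \<le> (\<Sum>n<Suc n. (cmod (coef x n))\<^sup>2)"
      by (rule member_le_sum) auto
    also have "\<dots> \<le> (norm x)\<^sup>2"
      by (rule bessel)
    finally show "(cmod (coef x n))\<^sup>2 \<le> (norm x)\<^sup>2" .
  qed simp
  have F: "(\<lambda>n. coef x n * w ^ n) sums (\<Sum>n. coef x n * w ^ n)" if "w \<in> ball 0 1" for w
  proof (rule summable_sums, rule summable_comparison_test')
    show "summable (\<lambda>n. norm x * cmod w ^ n)"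
      using that by (intro summable_mult summable_geometric) auto
    show "norm (coef x n * w ^ n) \<le> norm x * cmod w ^ n" for n
      using le[of n] by (auto simp: norm_mult norm_power intro: mult_right_mono)
  qed
  show "g \<in> H2"
    unfolding mem_H2_iff by (rule exI, rule h2_boundary_power_series[OF F assms])
  show "x - g \<in> ortho_compl H2"
    using coef_sums[OF assms]
    by (intro ortho_H2_if_coef_eq_0) (simp add: coef_def cinner_diff_left)
qed

lemma riesz_decomposition: "\<exists>g\<in>H2. x - g \<in> ortho_compl H2"
  using analytic_part summable_zpow[OF summable_coef, of x] summable_sums by blast

text \<open>An element of \<open>H2\<close> differs from its analytic part by a vector in \<open>H2\<close> that is orthogonal to \<open>H2\<close>,
  hence by \<open>0\<close>. In this form closure under the vector space operations is immediate.\<close>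

lemma mem_H2_iff_sums: "x \<in> H2 \<longleftrightarrow> (\<lambda>n. scaleC_l2 (coef x n) (zpow n)) sums x"
proof
  assume x: "x \<in> H2"
  obtain g where g: "(\<lambda>n. scaleC_l2 (coef x n) (zpow n)) sums g"
    using summable_zpow[OF summable_coef] summable_sums by blast
  from analytic_part[OF g] x have "cinner_l2 x (x - g) = 0" "cinner_l2 g (x - g) = 0"
    by (auto dest: ortho_complD)
  then have "x - g = 0"
    by (intro eq_0_if_self_ortho) (simp add: cinner_diff_left)
  with g show "(\<lambda>n. scaleC_l2 (coef x n) (zpow n)) sums x" by simp
next
  assume "(\<lambda>n. scaleC_l2 (coef x n) (zpow n)) sums x"
  then show "x \<in> H2" by (rule analytic_part)
qed

lemma H2_add: "x \<in> H2 \<Longrightarrow> y \<in> H2 \<Longrightarrow> x + y \<in> H2"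
  unfolding mem_H2_iff_sums coef_def cinner_add_left l2.scale_left_distrib by (rule sums_add)

lemma H2_scale: "x \<in> H2 \<Longrightarrow> scaleC_l2 c x \<in> H2"
  unfolding mem_H2_iff_sums coef_def cinner_scale_left
  using bounded_linear.sums[OF bounded_linear_scaleC] by fastforce

lemma H2_diff: "x \<in> H2 \<Longrightarrow> y \<in> H2 \<Longrightarrow> x - y \<in> H2"
  using H2_add[of x "scaleC_l2 (-1) y"] H2_scale[of y "-1"] by (simp add: l2.scale_minus_left)

lemma zpow_mem_H2: "zpow m \<in> H2"
proof -
  have "(\<lambda>n. scaleC_l2 (coef (zpow m) n) (zpow n)) = (\<lambda>n. if n = m then zpow m else 0)"
    by (auto simp: coef_def cinner_zpow)
  then show ?thesis
    using sums_single[of m "\<lambda>_. zpow m"] by (simp add: mem_H2_iff_sums)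
qed

lemma mem_ortho_H2_iff: "y \<in> ortho_compl H2 \<longleftrightarrow> (\<forall>n. coef y n = 0)"
  using ortho_H2_if_coef_eq_0 zpow_mem_H2 by (auto simp: coef_def ortho_compl_def)

lemma H2_ortho_eq_0: "x \<in> H2 \<Longrightarrow> x \<in> ortho_compl H2 \<Longrightarrow> x = 0"
  by (intro eq_0_if_self_ortho ortho_complD)

lemma H2_const:
  assumes "x \<in> H2" "\<And>n. coef x (Suc n) = 0"
  shows "x = scaleC_l2 (coef x 0) (zpow 0)"
proof -
  let ?y = "x - scaleC_l2 (coef x 0) (zpow 0)"
  have "coef ?y n = 0" for n
    using assms(2) by (cases n) (auto simp: coef_def cinner_diff_left cinner_scale_left cinner_zpow)
  moreover have "?y \<in> H2"
    by (intro H2_diff assms H2_scale zpow_mem_H2)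
  ultimately have "?y = 0"
    by (intro H2_ortho_eq_0) (simp_all add: mem_ortho_H2_iff)
  then show ?thesis by simp
qed

section \<open>Multiplication operators\<close>

lemma ess_bounded_mult:
  assumes "ess_bounded \<phi>" "ess_bounded \<psi>"
  shows "ess_bounded (\<lambda>z. \<phi> z * \<psi> z)"
proof -
  obtain C D where "AE z in circle_measure. cmod (\<phi> z) \<le> C" "AE z in circle_measure. cmod (\<psi> z) \<le> D"
    using assms by (auto simp: ess_bounded_def)
  then have "AE z in circle_measure. cmod (\<phi> z * \<psi> z) \<le> C * D"
    by eventually_elim (auto simp: norm_mult intro!: mult_mono intro: order_trans[OF norm_ge_zero])
  then show ?thesis
    using assms by (auto simp: ess_bounded_def)
qed

lemma ess_bounded_cnj: "ess_bounded \<phi> \<Longrightarrow> ess_bounded (\<lambda>z. cnj (\<phi> z))"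
  by (auto simp: ess_bounded_def intro: borel_measurable_cnj)

lemma mult_l2_cong_AE:
  assumes "ess_bounded \<phi>" "ess_bounded \<psi>" "AE z in circle_measure. \<phi> z = \<psi> z"
  shows "mult_l2 \<phi> x = mult_l2 \<psi> x"
proof (cases x)
  case (l2_of f)
  have "AE z in circle_measure. \<phi> z * f z = \<psi> z * f z"
    using assms(3) by eventually_elim simp
  then show ?thesis
    using assms l2_of by (simp add: l2_of_mult l2_of_eq_iff square_integrable_mult)
qed

lemma mult_mult_l2:
  assumes "ess_bounded \<phi>" "ess_bounded \<psi>"
  shows "mult_l2 \<phi> (mult_l2 \<psi> x) = mult_l2 (\<lambda>z. \<phi> z * \<psi> z) x"
  using assms by (cases x) (simp add: l2_of_mult square_integrable_mult ess_bounded_mult mult.assoc)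

lemma ess_bounded_const: "ess_bounded (\<lambda>z. c)"
  by (intro continuous_on_circle_ess_bounded continuous_intros)

lemma mult_l2_1 [simp]: "mult_l2 (\<lambda>z. 1) x = x"
  by (cases x) (simp add: l2_of_mult ess_bounded_const)

lemma mult_l2_const: "mult_l2 (\<lambda>z. c) x = scaleC_l2 c x"
  by (cases x) (simp add: l2_of_mult l2_of_scaleC ess_bounded_const)

lemma mult_l2_add:
  assumes "ess_bounded \<phi>" shows "mult_l2 \<phi> (x + y) = mult_l2 \<phi> x + mult_l2 \<phi> y"
  using assms by (cases x; cases y)
    (simp add: l2_of_add l2_of_mult square_integrable_add square_integrable_mult ring_distribs)

lemma mult_l2_scale:
  assumes "ess_bounded \<phi>" shows "mult_l2 \<phi> (scaleC_l2 c x) = scaleC_l2 c (mult_l2 \<phi> x)"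
  using assms by (cases x)
    (simp add: l2_of_scaleC l2_of_mult square_integrable_scale square_integrable_mult mult.left_commute)

lemma mult_l2_diff:
  assumes "ess_bounded \<phi>" shows "mult_l2 \<phi> (x - y) = mult_l2 \<phi> x - mult_l2 \<phi> y"
  using mult_l2_add[OF assms, of "x - y" y] by (simp add: algebra_simps)

lemma mult_l2_0 [simp]: "mult_l2 \<phi> 0 = 0"
  by (cases "ess_bounded \<phi>") (simp_all add: zero_l2_def l2_of_mult square_integrable_zero mult_l2.abs_eq l2_eq_def)

lemma mult_l2_symbol_diff:
  assumes "ess_bounded \<phi>" "ess_bounded \<psi>" "ess_bounded (\<lambda>z. \<phi> z - \<psi> z)"
  shows "mult_l2 (\<lambda>z. \<phi> z - \<psi> z) x = mult_l2 \<phi> x - mult_l2 \<psi> x"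
  using assms by (cases x)
    (simp add: l2_of_mult l2_of_diff square_integrable_mult ring_distribs)

lemma cinner_mult_l2:
  assumes "ess_bounded \<phi>"
  shows "cinner_l2 (mult_l2 \<phi> x) y = cinner_l2 x (mult_l2 (\<lambda>z. cnj (\<phi> z)) y)"
  using assms by (cases x; cases y)
    (simp add: l2_of_mult cinner_l2_of square_integrable_mult ess_bounded_cnj mult.assoc mult.left_commute)

lemma mult_l2_eq_0D:
  assumes "ess_bounded \<phi>" "AE z in circle_measure. \<phi> z \<noteq> 0" "mult_l2 \<phi> x = 0"
  shows "x = 0"
proof (cases x)
  case (l2_of f)
  then have "AE z in circle_measure. \<phi> z * f z = 0"
    using assms(1,3) l2_of_eq_iff[OF square_integrable_mult[OF assms(1) l2_of(1)] square_integrable_zero]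
    by (simp add: l2_of_mult zero_l2_def)
  with assms(2) have "AE z in circle_measure. f z = 0"
    by eventually_elim simp
  then show ?thesis
    using l2_of l2_of_eq_iff[OF l2_of(1) square_integrable_zero] by (simp add: zero_l2_def)
qed

section \<open>Multiplication by bounded analytic functions\<close>

text \<open>\<open>B\<close> lives in the disk and \<open>b\<close> on the circle; keeping both covers functions that are continuous on
  the closed disk (with \<open>b = B\<close>) as well as inner functions (with \<open>b = radial_limit B\<close>).\<close>

definition bounded_analytic :: "(complex \<Rightarrow> complex) \<Rightarrow> (complex \<Rightarrow> complex) \<Rightarrow> bool" where
  "bounded_analytic B b \<longleftrightarrow>
     B holomorphic_on ball 0 1 \<and> bounded (B ` ball 0 1) \<and> b \<in> borel_measurable circle_measure \<and>
     (AE z in circle_measure. ((\<lambda>r. B (of_real r * z)) \<longlongrightarrow> b z) (at_left 1))"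

lemma bounded_analytic_bound:
  assumes "bounded_analytic B b"
  obtains C where "C \<ge> 0" "\<And>w. w \<in> ball 0 1 \<Longrightarrow> cmod (B w) \<le> C"
    "AE z in circle_measure. cmod (b z) \<le> C"
proof -
  obtain C where C: "\<And>w. w \<in> ball 0 1 \<Longrightarrow> cmod (B w) \<le> C"
    using assms unfolding bounded_analytic_def bounded_iff by blast
  have "C \<ge> 0"
    using order_trans[OF norm_ge_zero C[of 0]] by simp
  moreover have "AE z in circle_measure. cmod (b z) \<le> C"
  proof -
    have "AE z in circle_measure. ((\<lambda>r. B (of_real r * z)) \<longlongrightarrow> b z) (at_left 1)"
      using assms by (simp add: bounded_analytic_def)
    with AE_space show ?thesis
    proof eventually_elim
      case (elim z)
      have "\<forall>\<^sub>F r in at_left 1. cmod (B (of_real r * z)) \<le> C"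
        using eventually_at_left_1
        by eventually_elim (use elim(1) in \<open>auto intro!: C simp: norm_mult\<close>)
      then show ?case
        by (rule tendsto_upperbound[OF tendsto_norm[OF elim(2)]]) simp
    qed
  qed
  ultimately show ?thesis
    using that[of C] C by blast
qed

lemma bounded_analytic_ess_bounded:
  assumes "bounded_analytic B b" shows "ess_bounded b"
proof -
  obtain C where "AE z in circle_measure. cmod (b z) \<le> C"
    using bounded_analytic_bound[OF assms] by metis
  then show ?thesis
    using assms by (auto simp: ess_bounded_def bounded_analytic_def)
qed

lemma bounded_analytic_dilation_ess_bounded:
  assumes "bounded_analytic B b" "0 < r" "r < 1"
  shows "ess_bounded (\<lambda>z. B (of_real r * z))"
  using assms
  by (intro continuous_on_circle_ess_bounded continuous_on_dilation) (auto simp: bounded_analytic_def)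

lemma bounded_analytic_continuous:
  assumes "B holomorphic_on ball 0 1" "continuous_on (cball 0 1) B"
  shows "bounded_analytic B B"
proof -
  have "bounded (B ` cball 0 1)"
    by (intro compact_imp_bounded compact_continuous_image assms) auto
  then have "bounded (B ` ball 0 1)"
    by (rule bounded_subset) auto
  moreover have "B \<in> borel_measurable circle_measure"
    by (intro continuous_on_circle_measurable continuous_on_subset[OF assms(2)]) auto
  moreover have "((\<lambda>r. B (of_real r * z)) \<longlongrightarrow> B z) (at_left (1::real))" if z: "z \<in> sphere 0 1" for z
  proof -
    have "((\<lambda>r. of_real r * z) \<longlongrightarrow> of_real 1 * z) (at_left (1::real))"
      by (intro tendsto_intros)
    then have lim: "((\<lambda>r. of_real r * z) \<longlongrightarrow> z) (at_left (1::real))"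
      by simp
    have ev: "\<forall>\<^sub>F r in at_left (1::real). of_real r * z \<in> cball 0 1"
      using eventually_at_left_1 by eventually_elim (use z in \<open>auto simp: norm_mult\<close>)
    show ?thesis
      by (rule continuous_on_tendsto_compose[OF assms(2) lim _ ev]) (use z in simp)
  qed
  ultimately show ?thesis
    using assms by (auto simp: bounded_analytic_def intro!: AE_I2)
qed

text \<open>Dominated convergence: if \<open>C\<close> bounds \<open>B\<close>, it bounds the boundary function as well, and the integrand
  is at most \<open>(2 * C)\<^sup>2 * (cmod (f z))\<^sup>2\<close>.\<close>

lemma mult_dilation_tendsto:
  assumes "bounded_analytic B b"
  shows "((\<lambda>r. mult_l2 (\<lambda>z. B (of_real r * z)) x) \<longlongrightarrow> mult_l2 b x) (at_left 1)"
proof (rule tendsto_at_left_sequentially[of 0])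
  fix S :: "nat \<Rightarrow> real"
  assume S: "\<And>n. S n < 1" "\<And>n. 0 < S n" "S \<longlonglongrightarrow> 1"
  obtain C where C: "C \<ge> 0" "\<And>w. w \<in> ball 0 1 \<Longrightarrow> cmod (B w) \<le> C"
    "AE z in circle_measure. cmod (b z) \<le> C"
    using bounded_analytic_bound[OF assms] by metis
  have S_lim: "filterlim S (at_left 1) sequentially"
    using S by (auto simp: filterlim_at intro!: always_eventually less_imp_neq)
  have lim: "AE z in circle_measure. ((\<lambda>r. B (of_real r * z)) \<longlongrightarrow> b z) (at_left 1)"
    using assms by (simp add: bounded_analytic_def)
  define \<phi> where "\<phi> n z = B (of_real (S n) * z)" for n z
  note b_bd = bounded_analytic_ess_bounded[OF assms]
  have \<phi>_bd: "ess_bounded (\<phi> n)" for n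
    unfolding \<phi>_def by (rule bounded_analytic_dilation_ess_bounded[OF assms S(2) S(1)])
  obtain f where f: "square_integrable f" "x = l2_of f"
    by (rule l2_of_cases)
  note sq = square_integrable_diff[OF square_integrable_mult[OF \<phi>_bd f(1)] square_integrable_mult[OF b_bd f(1)]]
  have "(\<lambda>n. integral\<^sup>L circle_measure (\<lambda>z. (cmod (\<phi> n z * f z - b z * f z))\<^sup>2))
      \<longlonglongrightarrow> integral\<^sup>L circle_measure (\<lambda>z. 0)"
  proof (rule integral_dominated_convergence)
    show "(\<lambda>z. (cmod (\<phi> n z * f z - b z * f z))\<^sup>2) \<in> borel_measurable circle_measure" for n
      using sq[of n] by (auto simp: square_integrable_def)
    show "integrable circle_measure (\<lambda>z. (2 * C)\<^sup>2 * (cmod (f z))\<^sup>2)"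
      using f(1) by (auto simp: square_integrable_def)
    show "AE z in circle_measure. (\<lambda>n. (cmod (\<phi> n z * f z - b z * f z))\<^sup>2) \<longlonglongrightarrow> 0"
      using lim
    proof eventually_elim
      case (elim z)
      have "(\<lambda>n. \<phi> n z) \<longlonglongrightarrow> b z"
        unfolding \<phi>_def by (rule filterlim_compose[OF elim S_lim])
      then have "(\<lambda>n. (cmod (\<phi> n z * f z - b z * f z))\<^sup>2) \<longlonglongrightarrow> (cmod (b z * f z - b z * f z))\<^sup>2"
        by (intro tendsto_intros)
      then show ?case by simp
    qed
    show "AE z in circle_measure. norm ((cmod (\<phi> n z * f z - b z * f z))\<^sup>2) \<le> (2 * C)\<^sup>2 * (cmod (f z))\<^sup>2" for n
      using AE_space C(3)
    proof eventually_elim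
      case (elim z)
      have "cmod (\<phi> n z) \<le> C"
        unfolding \<phi>_def using elim(1) S(1,2)[of n] by (intro C(2)) (auto simp: norm_mult)
      then have "cmod (\<phi> n z - b z) \<le> 2 * C"
        using norm_triangle_ineq4[of "\<phi> n z" "b z"] elim(2) by linarith
      then have "cmod (\<phi> n z - b z) * cmod (f z) \<le> 2 * C * cmod (f z)"
        by (intro mult_right_mono) auto
      then have "cmod (\<phi> n z * f z - b z * f z) \<le> 2 * C * cmod (f z)"
        by (simp add: norm_mult[symmetric] left_diff_distrib)
      then have "(cmod (\<phi> n z * f z - b z * f z))\<^sup>2 \<le> (2 * C * cmod (f z))\<^sup>2"
        by (intro power_mono) auto
      then show ?case by (simp add: power_mult_distrib)
    qed
  qed auto
  moreover have "integral\<^sup>L circle_measure (\<lambda>z. (cmod (\<phi> n z * f z - b z * f z))\<^sup>2)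
      = (norm (mult_l2 (\<phi> n) x - mult_l2 b x))\<^sup>2" for n
    unfolding f(2) l2_of_mult[OF f(1) \<phi>_bd] l2_of_mult[OF f(1) b_bd]
      l2_of_diff[OF square_integrable_mult[OF \<phi>_bd f(1)] square_integrable_mult[OF b_bd f(1)]]
    by (rule norm_l2_of_square[OF sq, symmetric])
  ultimately have "(\<lambda>n. (norm (mult_l2 (\<phi> n) x - mult_l2 b x))\<^sup>2) \<longlonglongrightarrow> 0"
    by simp
  from tendsto_real_sqrt[OF this] have "(\<lambda>n. norm (mult_l2 (\<phi> n) x - mult_l2 b x)) \<longlonglongrightarrow> 0"
    by simp
  then have "(\<lambda>n. mult_l2 (\<phi> n) x) \<longlonglongrightarrow> mult_l2 b x"
    by (simp add: Lim_null[of _ "mult_l2 b x"] tendsto_norm_zero_iff)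
  then show "(\<lambda>n. mult_l2 (\<lambda>z. B (of_real (S n) * z)) x) \<longlonglongrightarrow> mult_l2 b x"
    by (simp add: \<phi>_def[abs_def])
qed simp

text \<open>Writing \<open>B\<^sub>r\<close> for the dilation \<open>B (r z)\<close> and similarly for \<open>F\<close>, split
  \<open>B\<^sub>r F\<^sub>r = B\<^sub>r (F\<^sub>r - x) + B\<^sub>r x\<close>: the first term is small because the \<open>B\<^sub>r\<close> are
  uniformly bounded, and the second tends to \<open>b x\<close>.\<close>

lemma h2_boundary_mult:
  assumes B: "bounded_analytic B b" and F: "h2_boundary F x"
  shows "h2_boundary (\<lambda>w. B w * F w) (mult_l2 b x)"
proof -
  obtain C where C: "C \<ge> 0" "\<And>w. w \<in> ball 0 1 \<Longrightarrow> cmod (B w) \<le> C"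
    using bounded_analytic_bound[OF B] by metis
  have hol: "B holomorphic_on ball 0 1" "F holomorphic_on ball 0 1"
    using B F by (auto simp: bounded_analytic_def h2_boundary_def hardy_disk_def)
  let ?\<phi> = "\<lambda>r z. B (of_real r * z)"
  have bd: "ess_bounded (?\<phi> r)" if "0 \<le> r" "r < 1" for r :: real
    by (intro continuous_on_circle_ess_bounded continuous_on_dilation hol that)
  have mult: "dilation (\<lambda>w. B w * F w) r = mult_l2 (?\<phi> r) (dilation F r)" if "0 \<le> r" "r < 1" for r
    unfolding dilation_def
    by (intro l2_of_mult[symmetric] bd continuous_on_circle_square_integrable continuous_on_dilation hol that)
  have le: "norm (mult_l2 (?\<phi> r) y) \<le> C * norm y" if "0 \<le> r" "r < 1" for r :: real and y
    using that by (intro norm_mult_l2_le bd C(1) AE_I2 C(2)) (auto simp: norm_mult)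
  obtain D where D: "\<And>r. 0 \<le> r \<Longrightarrow> r < 1 \<Longrightarrow> norm (dilation F r) \<le> D"
    using F by (auto simp: h2_boundary_def hardy_disk_iff)
  have "norm (dilation (\<lambda>w. B w * F w) r) \<le> C * D" if "0 \<le> r" "r < 1" for r
    using le[OF that, of "dilation F r"] mult_left_mono[OF D[OF that] C(1)] mult[OF that] by simp
  then have "(\<lambda>w. B w * F w) \<in> hardy_disk"
    using hol by (auto simp: hardy_disk_iff intro!: holomorphic_intros)
  moreover have "(dilation (\<lambda>w. B w * F w) \<longlongrightarrow> mult_l2 b x) (at_left 1)"
  proof -
    have "((\<lambda>r. C * norm (dilation F r - x)) \<longlongrightarrow> 0) (at_left 1)"
      using F unfolding h2_boundary_def
      by (intro tendsto_mult_right_zero tendsto_norm_zero) (simp add: Lim_null[symmetric])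
    moreover have "\<forall>\<^sub>F r in at_left 1. norm (mult_l2 (?\<phi> r) (dilation F r - x)) \<le> C * norm (dilation F r - x)"
      by (rule eventually_mono[OF eventually_at_left_1]) (auto intro: le)
    ultimately have "((\<lambda>r. mult_l2 (?\<phi> r) (dilation F r - x)) \<longlongrightarrow> 0) (at_left 1)"
      by (rule Lim_null_comparison[rotated])
    from tendsto_add[OF this mult_dilation_tendsto[OF B, of x]]
    have lim: "((\<lambda>r. mult_l2 (?\<phi> r) (dilation F r - x) + mult_l2 (?\<phi> r) x) \<longlongrightarrow> mult_l2 b x) (at_left 1)"
      by simp
    show ?thesis
    proof (rule Lim_transform_eventually[OF lim])
      show "\<forall>\<^sub>F r in at_left 1. mult_l2 (?\<phi> r) (dilation F r - x) + mult_l2 (?\<phi> r) x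
          = dilation (\<lambda>w. B w * F w) r"
        by (rule eventually_mono[OF eventually_at_left_1]) (simp add: mult mult_l2_add[OF bd, symmetric])
    qed
  qed
  ultimately show ?thesis by (simp add: h2_boundary_def)
qed

lemma mult_mem_H2: "bounded_analytic B b \<Longrightarrow> x \<in> H2 \<Longrightarrow> mult_l2 b x \<in> H2"
  using h2_boundary_mult by (metis mem_H2_iff)

lemma zpow_0: "zpow 0 = l2_of (\<lambda>z. 1)"
  by (simp add: zpow_def)

lemma mult_zpow_0: "ess_bounded b \<Longrightarrow> mult_l2 b (zpow 0) = l2_of b"
  by (simp add: zpow_0 l2_of_mult square_integrable_def)

lemma h2_boundary_1: "h2_boundary (\<lambda>w. 1) (zpow 0)"
proof (rule h2_boundary_power_series)
  show "(\<lambda>n. (if n = 0 then 1 else 0) * w ^ n) sums 1" for w :: complex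
    using powser_sums_zero_iff[of "\<lambda>n. if n = 0 then 1 else 0" 1] sums_single[of 0 "\<lambda>_. 1::complex"]
    by (simp add: if_distrib[of "\<lambda>c. c * _"] cong: if_cong)
  show "(\<lambda>n. scaleC_l2 (if n = 0 then 1 else 0) (zpow n)) sums zpow 0"
    using sums_single[of 0 zpow] by (simp add: if_distrib[of "\<lambda>c. scaleC_l2 c _"] cong: if_cong)
qed

lemma h2_boundary_bounded_analytic: "bounded_analytic B b \<Longrightarrow> h2_boundary B (l2_of b)"
  using h2_boundary_mult[OF _ h2_boundary_1] by (simp add: mult_zpow_0 bounded_analytic_ess_bounded)

section \<open>Boundary values of inner functions\<close>

lemma convergent_filter_iff_cauchy:
  fixes f :: "'b \<Rightarrow> 'a::complete_space"
  assumes "F \<noteq> bot"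
  shows "(\<exists>l. (f \<longlongrightarrow> l) F) \<longleftrightarrow>
    (\<forall>e>0. \<exists>P. eventually P F \<and> (\<forall>x y. P x \<and> P y \<longrightarrow> dist (f x) (f y) < e))"
proof -
  have "(\<exists>l. (f \<longlongrightarrow> l) F) \<longleftrightarrow> cauchy_filter (filtermap f F)"
    using complete_UNIV[where 'a = 'a] assms nhds_imp_cauchy_filter
    unfolding filterlim_def complete_uniform by (auto simp: filtermap_bot_iff)
  then show ?thesis
    by (simp add: cauchy_filter_metric_filtermap)
qed

text \<open>The set \<open>L\<close> where the radial limit exists is described by the Cauchy criterion. For a fixed
  accuracy and a fixed range of radii the criterion is an intersection of closed conditions, so it
  defines a closed set although there are uncountably many radii; hence \<open>L\<close> is Borel. On \<open>L\<close> the
  radial limit is the limit along a sequence of radii, and off \<open>L\<close> it is one fixed default value.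
  This measurability is needed to make the radial limit a legitimate multiplication symbol.\<close>

lemma radial_limit_measurable:
  assumes "F holomorphic_on ball 0 1"
  shows "radial_limit F \<in> borel_measurable circle_measure"
proof -
  \<comment> \<open>the shift by \<open>2\<close> keeps the radii positive\<close>
  define I where "I m = {1 - 1 / (real m + 2)<..<1}" for m :: nat
  have I: "0 \<le> r" "r < 1" if "r \<in> I m" for r m
  proof -
    have "1 / (real m + 2) \<le> 1" by simp
    moreover have "1 - 1 / (real m + 2) < r" "r < 1" using that by (auto simp: I_def)
    ultimately show "0 \<le> r" "r < 1" by linarith+
  qed
  define A where "A k m = {z \<in> sphere 0 1. \<forall>r\<in>I m. \<forall>s\<in>I m.
      dist (F (of_real r * z)) (F (of_real s * z)) \<le> 1 / (real k + 1)}" for k m :: nat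
  have closed: "closed (A k m)" for k m
  proof -
    have cl: "closed (sphere 0 1 \<inter> (\<lambda>z. dist (F (of_real r * z)) (F (of_real s * z))) -` {..1 / (real k + 1)})"
      if "r \<in> I m" "s \<in> I m" for r s
      using that I[of r m] I[of s m]
      by (intro continuous_closed_preimage continuous_on_dist continuous_on_dilation assms) auto
    have A_eq: "A k m = sphere 0 1 \<inter> (\<Inter>r\<in>I m. \<Inter>s\<in>I m. sphere 0 1 \<inter>
        (\<lambda>z. dist (F (of_real r * z)) (F (of_real s * z))) -` {..1 / (real k + 1)})"
      by (auto simp: A_def)
    show ?thesis
      unfolding A_eq by (intro closed_Int closed_INT ballI cl closed_sphere)
  qed
  define L where "L = (\<Inter>k. \<Union>m. A k m)"
  have L_iff: "(\<exists>l. ((\<lambda>r. F (of_real r * z)) \<longlongrightarrow> l) (at_left (1::real))) \<longleftrightarrow> z \<in> L"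
    if z: "z \<in> sphere 0 1" for z
  proof -
    have ev_I: "\<forall>\<^sub>F r in at_left 1. r \<in> I m" for m
      using eventually_at_left_real[of "1 - 1 / (real m + 2)" 1] by (simp add: I_def)
    have I_small: "\<exists>m. \<forall>r\<in>I m. P r" if P: "\<forall>\<^sub>F r in at_left 1. P r" for P
    proof -
      obtain b where b: "b < 1" "\<And>r. b < r \<Longrightarrow> r < 1 \<Longrightarrow> P r"
        using P unfolding eventually_at_left[OF zero_less_one] by blast
      obtain m where m: "inverse (real (Suc m)) < 1 - b"
        using reals_Archimedean[of "1 - b"] b(1) by auto
      have "1 / (real m + 2) \<le> inverse (real (Suc m))"
        by (simp add: field_simps)
      with m have "b \<le> 1 - 1 / (real m + 2)" by linarith
      then show ?thesis using b(2) by (intro exI[of _ m]) (auto simp: I_def)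
    qed
    have "(\<exists>l. ((\<lambda>r. F (of_real r * z)) \<longlongrightarrow> l) (at_left (1::real))) \<longleftrightarrow>
      (\<forall>e>0. \<exists>P. eventually P (at_left (1::real)) \<and>
        (\<forall>r s. P r \<and> P s \<longrightarrow> dist (F (of_real r * z)) (F (of_real s * z)) < e))"
      by (rule convergent_filter_iff_cauchy) simp
    also have "\<dots> \<longleftrightarrow> (\<forall>k. \<exists>m. z \<in> A k m)"
    proof (intro iffI allI impI)
      fix k
      assume *: "\<forall>e>0. \<exists>P. eventually P (at_left (1::real)) \<and>
        (\<forall>r s. P r \<and> P s \<longrightarrow> dist (F (of_real r * z)) (F (of_real s * z)) < e)"
      have "1 / (real k + 1) > 0" by simp
      with * obtain P where P: "eventually P (at_left (1::real))"
        "\<And>r s. P r \<Longrightarrow> P s \<Longrightarrow> dist (F (of_real r * z)) (F (of_real s * z)) < 1 / (real k + 1)"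
        by blast
      obtain m where "\<forall>r\<in>I m. P r" using I_small[OF P(1)] by blast
      then have "z \<in> A k m"
        using z P(2) by (auto simp: A_def intro!: less_imp_le)
      then show "\<exists>m. z \<in> A k m" by blast
    next
      fix e :: real
      assume *: "\<forall>k. \<exists>m. z \<in> A k m" and "e > 0"
      then obtain k where k: "inverse (real (Suc k)) < e"
        using reals_Archimedean by blast
      obtain m where m: "z \<in> A k m" using * by blast
      have "\<forall>r s. r \<in> I m \<and> s \<in> I m \<longrightarrow> dist (F (of_real r * z)) (F (of_real s * z)) < e"
        using m k by (fastforce simp: A_def inverse_eq_divide add.commute)
      then show "\<exists>P. eventually P (at_left (1::real)) \<and>
        (\<forall>r s. P r \<and> P s \<longrightarrow> dist (F (of_real r * z)) (F (of_real s * z)) < e)"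
        using ev_I[of m] by (intro exI[of _ "\<lambda>r. r \<in> I m"]) auto
    qed
    finally show ?thesis by (auto simp: L_def)
  qed
  define x where "x n = 1 - 1 / (real n + 2)" for n :: nat
  have x01: "0 \<le> x n" "x n < 1" for n
    by (auto simp: x_def)
  have x_lim: "filterlim x (at_left 1) sequentially"
  proof -
    have "(\<lambda>n. 1 - inverse (real (Suc (Suc n)))) \<longlonglongrightarrow> 1 - 0"
      by (intro tendsto_intros LIMSEQ_Suc[OF LIMSEQ_inverse_real_of_nat])
    then have "x \<longlonglongrightarrow> 1"
      by (simp add: x_def[abs_def] inverse_eq_divide add.commute)
    then show ?thesis
      using x01 by (auto simp: filterlim_at intro!: always_eventually less_imp_neq)
  qed
  have eq: "radial_limit F z = (if z \<in> L then lim (\<lambda>n. F (of_real (x n) * z)) else THE l. False)"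
    if z: "z \<in> space circle_measure" for z
  proof (cases "z \<in> L")
    case True
    then obtain l where l: "((\<lambda>r. F (of_real r * z)) \<longlongrightarrow> l) (at_left (1::real))"
      using L_iff[of z] z by auto
    have "(\<lambda>n. F (of_real (x n) * z)) \<longlonglongrightarrow> l"
      by (rule filterlim_compose[OF l x_lim])
    moreover have "radial_limit F z = l"
      unfolding radial_limit_def by (rule tendsto_Lim[OF _ l]) simp
    ultimately show ?thesis
      using True by (simp add: limI)
  next
    case False
    then have "\<not> ((\<lambda>r. F (of_real r * z)) \<longlongrightarrow> l) (at_left (1::real))" for l
      using L_iff[of z] z by auto
    then show ?thesis
      using False by (simp add: radial_limit_def Topological_Spaces.Lim_def)
  qed
  have [measurable]: "(\<lambda>z. F (of_real (x n) * z)) \<in> borel_measurable circle_measure" for n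
    by (intro continuous_on_circle_measurable continuous_on_dilation assms x01)
  have "L \<in> sets borel"
    unfolding L_def using closed by (intro sets.countable_INT sets.countable_UN) auto
  then have "L \<inter> space circle_measure \<in> sets circle_measure"
    by (auto simp: sets_circle sets_restrict_space Int_commute)
  then have "(\<lambda>z. if z \<in> L then lim (\<lambda>n. F (of_real (x n) * z)) else THE l. False)
      \<in> borel_measurable circle_measure"
    by (intro measurable_If_set) auto
  then show ?thesis
    by (subst measurable_cong[OF eq])
qed

lemma inner_bounded_analytic:
  assumes "inner_function \<theta>"
  shows "bounded_analytic \<theta> (radial_limit \<theta>)"
  using assms radial_limit_measurable by (auto simp: inner_function_def bounded_analytic_def)

section \<open>Resolvents and the conjugate shift on \<open>H\<^sup>2\<close>\<close>

lemma ess_bounded_id_minus: "ess_bounded (\<lambda>z. z - l)"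
  by (intro continuous_on_circle_ess_bounded continuous_intros)

lemma ess_bounded_cnj_minus: "ess_bounded (\<lambda>z. cnj z - cnj l)"
  by (intro continuous_on_circle_ess_bounded continuous_intros)

lemma ess_bounded_one_minus: "ess_bounded (\<lambda>z. 1 - cnj l * z)"
  by (intro continuous_on_circle_ess_bounded continuous_intros)

lemma ess_bounded_id: "ess_bounded (\<lambda>z. z)"
  by (intro continuous_on_circle_ess_bounded continuous_intros)

lemma ess_bounded_conj: "ess_bounded cnj"
  by (intro continuous_on_circle_ess_bounded continuous_intros)

lemma bounded_analytic_id: "bounded_analytic (\<lambda>z. z) (\<lambda>z. z)"
  by (intro bounded_analytic_continuous holomorphic_intros continuous_intros)

lemma bounded_analytic_id_minus: "bounded_analytic (\<lambda>z. z - l) (\<lambda>z. z - l)"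
  by (intro bounded_analytic_continuous holomorphic_intros continuous_intros)

lemma bounded_analytic_one_minus: "bounded_analytic (\<lambda>z. 1 - cnj l * z) (\<lambda>z. 1 - cnj l * z)"
  by (intro bounded_analytic_continuous holomorphic_intros continuous_intros)

lemma mult_l2_id_zpow: "mult_l2 (\<lambda>z. z) (zpow n) = zpow (Suc n)"
  by (simp add: zpow_def l2_of_mult[OF square_integrable_power ess_bounded_id])

lemma coef_mult_cnj: "coef (mult_l2 cnj x) n = coef x (Suc n)"
  unfolding coef_def cinner_mult_l2[OF ess_bounded_conj] complex_cnj_cnj mult_l2_id_zpow ..

lemma mult_unit_l2:
  assumes "ess_bounded \<phi>" "ess_bounded \<psi>" "AE z in circle_measure. \<phi> z * \<psi> z = 1"
  shows "mult_l2 \<phi> (mult_l2 \<psi> x) = x"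
  using mult_l2_cong_AE[OF ess_bounded_mult[OF assms(1,2)] ess_bounded_const assms(3), of x]
  by (simp add: mult_mult_l2 assms)

lemma AE_circle_I: "(\<And>z. cmod z = 1 \<Longrightarrow> P z) \<Longrightarrow> AE z in circle_measure. P z"
  by (rule AE_I2) simp

lemma circle_mult_cnj: "cmod z = 1 \<Longrightarrow> z * cnj z = 1"
  by (simp add: complex_norm_square[symmetric])

lemma mult_id_cnj: "mult_l2 (\<lambda>z. z) (mult_l2 cnj x) = x"
  by (intro mult_unit_l2 ess_bounded_id ess_bounded_conj AE_circle_I circle_mult_cnj)

lemma mult_cnj_id: "mult_l2 cnj (mult_l2 (\<lambda>z. z) x) = x"
  by (intro mult_unit_l2 ess_bounded_id ess_bounded_conj AE_circle_I)
    (simp add: circle_mult_cnj mult.commute)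

text \<open>Multiplication by \<open>cnj b\<close> is adjoint to multiplication by \<open>b\<close>, which maps \<open>H2\<close> into itself.\<close>

lemma mult_cnj_ortho_H2:
  assumes "bounded_analytic B b" "y \<in> ortho_compl H2"
  shows "mult_l2 (\<lambda>z. cnj (b z)) y \<in> ortho_compl H2"
  unfolding mem_ortho_compl_iff
proof
  fix x assume "x \<in> H2"
  then have "cinner_l2 (mult_l2 b x) y = 0"
    using mult_mem_H2[OF assms(1)] assms(2) by (blast intro: ortho_complD)
  then show "cinner_l2 x (mult_l2 (\<lambda>z. cnj (b z)) y) = 0"
    by (simp add: cinner_mult_l2 bounded_analytic_ess_bounded[OF assms(1)])
qed

text \<open>A vanishing constant coefficient allows division by \<open>z\<close>. The part \<open>?y\<close> of the quotient that is
  orthogonal to \<open>H2\<close> satisfies \<open>z ?y \<in> H2\<close>, and all Fourier coefficients of \<open>z ?y\<close> of nonnegative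
  index vanish, so \<open>?y = 0\<close>.\<close>

lemma mult_cnj_mem_H2:
  assumes "x \<in> H2" "coef x 0 = 0"
  shows "mult_l2 cnj x \<in> H2"
proof -
  obtain g where g: "g \<in> H2" "mult_l2 cnj x - g \<in> ortho_compl H2"
    using riesz_decomposition by blast
  let ?y = "mult_l2 cnj x - g"
  have zy: "mult_l2 (\<lambda>z. z) ?y = x - mult_l2 (\<lambda>z. z) g"
    by (simp add: mult_l2_diff ess_bounded_id mult_id_cnj)
  have "coef (mult_l2 (\<lambda>z. z) ?y) n = 0" for n
  proof (cases n)
    case 0
    have "coef (mult_l2 (\<lambda>z. z) g) 0 = 0"
      using g(1) coef_0_h2_boundary[OF h2_boundary_mult[OF bounded_analytic_id]]
      by (auto simp: mem_H2_iff)
    then show ?thesis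
      using 0 assms(2) zy by (simp add: coef_def cinner_diff_left)
  next
    case (Suc m)
    then have "coef (mult_l2 (\<lambda>z. z) ?y) n = coef ?y m"
      using coef_mult_cnj[of "mult_l2 (\<lambda>z. z) ?y" m] by (simp add: mult_cnj_id)
    then show ?thesis using g(2) by (simp add: mem_ortho_H2_iff)
  qed
  moreover have "mult_l2 (\<lambda>z. z) ?y \<in> H2"
    unfolding zy by (intro H2_diff assms(1) mult_mem_H2[OF bounded_analytic_id] g(1))
  ultimately have "mult_l2 (\<lambda>z. z) ?y = 0"
    by (intro H2_ortho_eq_0) (simp_all add: mem_ortho_H2_iff)
  then have "?y = mult_l2 cnj 0"
    using mult_cnj_id[of ?y] by simp
  then show ?thesis using g(1) by simp
qed

text \<open>The Szego kernel, the reproducing kernel of \<open>H2\<close> at the point \<open>l\<close>.\<close>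

definition szego :: "complex \<Rightarrow> complex \<Rightarrow> complex" where
  "szego l z = 1 / (1 - cnj l * z)"

lemma one_minus_nonzero:
  assumes "cmod l < 1" "cmod z \<le> 1"
  shows "1 - cnj l * z \<noteq> 0"
proof
  assume "1 - cnj l * z = 0"
  then have "cnj l * z = 1" by (metis eq_iff_diff_eq_0)
  then have "cmod (cnj l * z) = 1" by (simp only: norm_one)
  moreover have "cmod (cnj l * z) \<le> cmod l * 1"
    using assms unfolding norm_mult complex_mod_cnj by (intro mult_left_mono) auto
  ultimately show False using assms by simp
qed

lemma bounded_analytic_szego:
  assumes "cmod l < 1"
  shows "bounded_analytic (szego l) (szego l)"
  unfolding szego_def
  using one_minus_nonzero[OF assms]
  by (intro bounded_analytic_continuous holomorphic_intros continuous_intros) auto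

lemma szego_mem_H2: "cmod l < 1 \<Longrightarrow> l2_of (szego l) \<in> H2"
  using h2_boundary_bounded_analytic[OF bounded_analytic_szego] mem_H2_iff by blast

lemma one_minus_cnj_circle: "cmod z = 1 \<Longrightarrow> 1 - l * cnj z = (z - l) * cnj z"
  using circle_mult_cnj[of z] by (simp add: algebra_simps)

lemma cauchy_kernel_circle:
  assumes "cmod z = 1" "cmod l < 1"
  shows "1 / (z - l) = cnj z * cnj (szego l z)"
proof -
  have "z \<noteq> l" using assms by auto
  have "cnj z * cnj (szego l z) = cnj z / ((z - l) * cnj z)"
    using assms by (simp add: szego_def one_minus_cnj_circle)
  also have "\<dots> = 1 / (z - l)"
    using assms by auto
  finally show ?thesis ..
qed

lemma cauchy_kernel_continuous:
  "cmod l < 1 \<Longrightarrow> continuous_on (sphere 0 1) (\<lambda>z. 1 / (z - l))"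
  by (intro continuous_intros) auto

lemma cauchy_kernel_ess_bounded: "cmod l < 1 \<Longrightarrow> ess_bounded (\<lambda>z. 1 / (z - l))"
  by (intro continuous_on_circle_ess_bounded cauchy_kernel_continuous)

lemma cauchy_kernel_mem_H2_minus:
  assumes "cmod l < 1"
  shows "l2_of (\<lambda>z. 1 / (z - l)) \<in> H2_minus"
proof -
  have k: "square_integrable (szego l)"
    by (intro ess_bounded_square_integrable bounded_analytic_ess_bounded[OF bounded_analytic_szego[OF assms]])
  have "mult_l2 cnj (cnj_l2 (l2_of (szego l))) = l2_of (\<lambda>z. cnj z * cnj (szego l z))"
    by (simp add: l2_of_cnj[OF k] l2_of_mult[OF square_integrable_cnj[OF k] ess_bounded_conj])
  also have "\<dots> = l2_of (\<lambda>z. 1 / (z - l))"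
    using ess_bounded_square_integrable[OF cauchy_kernel_ess_bounded[OF assms]]
      square_integrable_mult[OF ess_bounded_conj square_integrable_cnj[OF k]]
    by (subst l2_of_eq_iff) (auto intro!: AE_circle_I simp: cauchy_kernel_circle[OF _ assms])
  finally show ?thesis
    using szego_mem_H2[OF assms] unfolding H2_minus_def by (auto intro!: image_eqI[where x = "l2_of (szego l)"])
qed

lemma H2_minus_scale:
  assumes "x \<in> H2_minus" shows "scaleC_l2 c x \<in> H2_minus"
proof -
  obtain y where y: "y \<in> H2" "x = mult_l2 cnj (cnj_l2 y)"
    using assms by (auto simp: H2_minus_def)
  have "scaleC_l2 c (cnj_l2 y) = cnj_l2 (scaleC_l2 (cnj c) y)"
    by (cases y) (simp add: l2_of_cnj l2_of_scaleC square_integrable_cnj square_integrable_scale)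
  then have "scaleC_l2 c x = mult_l2 cnj (cnj_l2 (scaleC_l2 (cnj c) y))"
    by (simp add: y mult_l2_scale[OF ess_bounded_conj, symmetric])
  then show ?thesis
    using H2_scale[OF y(1)] by (auto simp: H2_minus_def)
qed

text \<open>For \<open>x\<close> with disk function \<open>F\<close>, the inner product with the kernel is the mean of \<open>x\<close> times
  \<open>z / (1 - cnj l * z)\<close>. The product is analytic and vanishes at the origin, so its mean is \<open>0\<close>.\<close>

lemma cauchy_kernel_ortho_H2:
  assumes "cmod l < 1"
  shows "l2_of (\<lambda>z. 1 / (z - l)) \<in> ortho_compl H2"
  unfolding mem_ortho_compl_iff
proof
  fix x assume "x \<in> H2"
  then obtain F where F: "h2_boundary F x" by (auto simp: mem_H2_iff)
  note k = bounded_analytic_szego[OF assms]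
  let ?b = "\<lambda>z. z * szego l z"
  have b: "bounded_analytic ?b ?b"
    unfolding szego_def using one_minus_nonzero[OF assms]
    by (intro bounded_analytic_continuous holomorphic_intros continuous_intros) auto
  have "cinner_l2 (mult_l2 ?b x) (zpow 0) = 0"
    using coef_0_h2_boundary[OF h2_boundary_mult[OF b F]] by (simp add: coef_def)
  then have "cinner_l2 x (mult_l2 (\<lambda>z. cnj (?b z)) (zpow 0)) = 0"
    by (simp add: cinner_mult_l2[OF bounded_analytic_ess_bounded[OF b]])
  moreover have "mult_l2 (\<lambda>z. cnj (?b z)) (zpow 0) = mult_l2 (\<lambda>z. 1 / (z - l)) (zpow 0)"
    by (intro mult_l2_cong_AE ess_bounded_cnj bounded_analytic_ess_bounded[OF b]
        cauchy_kernel_ess_bounded assms AE_circle_I) (simp add: cauchy_kernel_circle assms)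
  ultimately show "cinner_l2 x (l2_of (\<lambda>z. 1 / (z - l))) = 0"
    by (simp add: mult_zpow_0[OF cauchy_kernel_ess_bounded[OF assms]])
qed

lemma mult_id_minus_eq_const:
  assumes "cmod l < 1" "mult_l2 (\<lambda>z. z - l) x = scaleC_l2 c (zpow 0)"
  shows "x = scaleC_l2 c (l2_of (\<lambda>z. 1 / (z - l)))"
proof -
  have "mult_l2 (\<lambda>z. 1 / (z - l)) (mult_l2 (\<lambda>z. z - l) x) = x"
    by (intro mult_unit_l2 cauchy_kernel_ess_bounded ess_bounded_id_minus AE_circle_I assms(1))
      (use assms(1) in auto)
  then show ?thesis
    by (simp add: assms(2) mult_l2_scale mult_zpow_0 cauchy_kernel_ess_bounded[OF assms(1)])
qed

lemma mult_one_minus_eq_const: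
  assumes "cmod l < 1" "mult_l2 (\<lambda>z. 1 - cnj l * z) x = scaleC_l2 c (zpow 0)"
  shows "x = scaleC_l2 c (l2_of (szego l))"
proof -
  note k = bounded_analytic_ess_bounded[OF bounded_analytic_szego[OF assms(1)]]
  have "mult_l2 (szego l) (mult_l2 (\<lambda>z. 1 - cnj l * z) x) = x"
    by (intro mult_unit_l2 k ess_bounded_one_minus AE_circle_I)
      (use one_minus_nonzero[OF assms(1)] in \<open>auto simp: szego_def\<close>)
  then show ?thesis
    by (simp add: assms(2) mult_l2_scale mult_zpow_0 k)
qed

section \<open>The model space and its orthogonal complement\<close>

lemma inner_ess_bounded: "inner_function \<theta> \<Longrightarrow> ess_bounded (radial_limit \<theta>)"
  by (rule bounded_analytic_ess_bounded[OF inner_bounded_analytic])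

lemma mult_cnj_inner:
  assumes "inner_function \<theta>"
  shows "mult_l2 (\<lambda>z. cnj (radial_limit \<theta> z)) (mult_l2 (radial_limit \<theta>) x) = x"
    and "mult_l2 (radial_limit \<theta>) (mult_l2 (\<lambda>z. cnj (radial_limit \<theta> z)) x) = x"
proof -
  have "AE z in circle_measure. cmod (radial_limit \<theta> z) = 1"
    using assms by (auto simp: inner_function_def elim: eventually_mono)
  then have unit: "AE z in circle_measure. radial_limit \<theta> z * cnj (radial_limit \<theta> z) = 1"
    by eventually_elim (rule circle_mult_cnj)
  note bd = inner_ess_bounded[OF assms] ess_bounded_cnj[OF inner_ess_bounded[OF assms]]
  show "mult_l2 (radial_limit \<theta>) (mult_l2 (\<lambda>z. cnj (radial_limit \<theta> z)) x) = x"
    by (intro mult_unit_l2 bd unit)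
  show "mult_l2 (\<lambda>z. cnj (radial_limit \<theta> z)) (mult_l2 (radial_limit \<theta>) x) = x"
    using unit by (intro mult_unit_l2 bd) (simp add: mult.commute)
qed

lemma cinner_mult_inner:
  assumes "inner_function \<theta>"
  shows "cinner_l2 (mult_l2 (radial_limit \<theta>) x) (mult_l2 (radial_limit \<theta>) y) = cinner_l2 x y"
  by (simp add: cinner_mult_l2 inner_ess_bounded assms mult_cnj_inner)

lemma mult_inner_mem_H2:
  "inner_function \<theta> \<Longrightarrow> x \<in> H2 \<Longrightarrow> mult_l2 (radial_limit \<theta>) x \<in> H2"
  by (rule mult_mem_H2[OF inner_bounded_analytic])

lemma coef_0_mult_inner:
  assumes "inner_function \<theta>" "x \<in> H2"
  shows "coef (mult_l2 (radial_limit \<theta>) x) 0 = \<theta> 0 * coef x 0"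
proof -
  obtain F where F: "h2_boundary F x" using assms(2) by (auto simp: mem_H2_iff)
  from coef_0_h2_boundary[OF this]
    coef_0_h2_boundary[OF h2_boundary_mult[OF inner_bounded_analytic[OF assms(1)] this]]
  show ?thesis by simp
qed

lemma mem_model_space_iff:
  "y \<in> model_space \<theta> \<longleftrightarrow> y \<in> H2 \<and> (\<forall>h\<in>H2. cinner_l2 y (mult_l2 (radial_limit \<theta>) h) = 0)"
  by (auto simp: model_space_def inner_H2_def ortho_compl_def)

lemma ortho_H2_subset_ortho_model: "m \<in> ortho_compl H2 \<Longrightarrow> m \<in> ortho_compl (model_space \<theta>)"
  by (auto simp: ortho_compl_def model_space_def)

lemma mult_inner_ortho_model:
  "p \<in> H2 \<Longrightarrow> mult_l2 (radial_limit \<theta>) p \<in> ortho_compl (model_space \<theta>)"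
  by (auto simp: mem_ortho_compl_iff mem_model_space_iff)

text \<open>The orthogonal decomposition of \<open>L\<^sup>2\<close> into the complement of \<open>H2\<close>, \<open>\<theta> H2\<close> and the model space, obtained
  by splitting \<open>x\<close> and then \<open>cnj \<theta>\<close> times its analytic part. Because \<open>\<theta>\<close> is unimodular on the circle,
  \<open>\<theta>\<close> times a vector orthogonal to \<open>H2\<close> is orthogonal to \<open>\<theta> H2\<close>.\<close>

lemma model_space_decomposition:
  assumes "inner_function \<theta>"
  obtains m p k where "x = m + mult_l2 (radial_limit \<theta>) p + k"
    "m \<in> ortho_compl H2" "p \<in> H2" "k \<in> model_space \<theta>"
proof -
  let ?t = "radial_limit \<theta>"
  obtain g where g: "g \<in> H2" "x - g \<in> ortho_compl H2"
    using riesz_decomposition by blast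
  obtain p where p: "p \<in> H2" "mult_l2 (\<lambda>z. cnj (?t z)) g - p \<in> ortho_compl H2"
    using riesz_decomposition by blast
  have k: "g - mult_l2 ?t p = mult_l2 ?t (mult_l2 (\<lambda>z. cnj (?t z)) g - p)"
    by (simp add: mult_l2_diff inner_ess_bounded assms mult_cnj_inner)
  have "g - mult_l2 ?t p \<in> H2"
    by (intro H2_diff g mult_inner_mem_H2 assms p)
  moreover have "cinner_l2 (g - mult_l2 ?t p) (mult_l2 ?t h) = 0" if "h \<in> H2" for h
    unfolding k cinner_mult_inner[OF assms] using p(2) that by (simp add: ortho_compl_def)
  ultimately have "g - mult_l2 ?t p \<in> model_space \<theta>"
    by (simp add: mem_model_space_iff)
  then show ?thesis
    using that[of "x - g" p "g - mult_l2 ?t p"] g p by simp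
qed

lemma mem_ortho_model_space:
  assumes "inner_function \<theta>" "x \<in> ortho_compl (model_space \<theta>)"
  obtains m p where "x = m + mult_l2 (radial_limit \<theta>) p" "m \<in> ortho_compl H2" "p \<in> H2"
proof -
  obtain m p k where d: "x = m + mult_l2 (radial_limit \<theta>) p + k"
    "m \<in> ortho_compl H2" "p \<in> H2" "k \<in> model_space \<theta>"
    using model_space_decomposition[OF assms(1)] by blast
  have "x - (m + mult_l2 (radial_limit \<theta>) p) \<in> ortho_compl (model_space \<theta>)"
    by (intro ortho_compl_diff ortho_compl_add assms ortho_H2_subset_ortho_model
        mult_inner_ortho_model d)
  then have "k \<in> ortho_compl (model_space \<theta>)"
    by (simp add: d(1))
  then have "k = 0"
    using d(4) by (intro eq_0_if_self_ortho ortho_complD)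
  with d show ?thesis using that by simp
qed

text \<open>The explicit decomposition provides the projection, so the definite description in \<open>ortho_proj\<close>
  is well defined here, and it shows that the double complement of the model space adds nothing.\<close>

lemma ortho_proj_eq_0_iff:
  assumes "inner_function \<theta>"
  shows "ortho_proj (ortho_compl (model_space \<theta>)) y = 0 \<longleftrightarrow> y \<in> model_space \<theta>"
proof -
  let ?N = "ortho_compl (model_space \<theta>)"
  have unique: "g = q" if "g \<in> ?N" "y - g \<in> ortho_compl ?N" "q \<in> ?N" "y - q \<in> ortho_compl ?N" for g q
  proof -
    have "g - q \<in> ?N"
      by (intro ortho_compl_diff that)
    moreover have "(y - q) - (y - g) \<in> ortho_compl ?N"
      by (intro ortho_compl_diff that)
    ultimately have "cinner_l2 (g - q) (g - q) = 0"
      by (intro ortho_complD) simp_all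
    then show ?thesis using eq_0_if_self_ortho by force
  qed
  have proj: "ortho_proj ?N y = q" if "q \<in> ?N" "y - q \<in> ortho_compl ?N" for q
    unfolding ortho_proj_def using that unique by (intro the_equality) blast+
  obtain m p k where d: "y = m + mult_l2 (radial_limit \<theta>) p + k"
    "m \<in> ortho_compl H2" "p \<in> H2" "k \<in> model_space \<theta>"
    using model_space_decomposition[OF assms] by blast
  have "ortho_proj ?N y = m + mult_l2 (radial_limit \<theta>) p"
  proof (rule proj)
    show "m + mult_l2 (radial_limit \<theta>) p \<in> ?N"
      by (intro ortho_compl_add ortho_H2_subset_ortho_model mult_inner_ortho_model d)
    show "y - (m + mult_l2 (radial_limit \<theta>) p) \<in> ortho_compl ?N"
      using ortho_compl_twice[OF d(4)] by (simp add: d(1))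
  qed
  then have "y \<in> model_space \<theta>" if "ortho_proj ?N y = 0"
    using that d by simp
  moreover have "ortho_proj ?N y = 0" if "y \<in> model_space \<theta>"
    using ortho_compl_twice[OF that] by (intro proj) (simp_all add: ortho_compl_0)
  ultimately show ?thesis by blast
qed

lemma mem_ker_dual_tto_iff:
  assumes "inner_function \<theta>"
  shows "x \<in> ker_dual_tto \<theta> \<phi> \<longleftrightarrow> x \<in> ortho_compl (model_space \<theta>) \<and> mult_l2 \<phi> x \<in> model_space \<theta>"
  by (simp add: ker_dual_tto_def dual_tto_def ortho_proj_eq_0_iff[OF assms])

lemma zero_mem_ker_dual_tto: "inner_function \<theta> \<Longrightarrow> 0 \<in> ker_dual_tto \<theta> \<phi>"
  by (simp add: mem_ker_dual_tto_iff ortho_compl_0 mem_model_space_iff)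
    (use H2_scale[OF zpow_mem_H2, of 0] in simp)

section \<open>The kernels\<close>

lemma zpow_nonzero: "zpow n \<noteq> 0"
proof
  assume "zpow n = 0"
  then show False using cinner_zpow[of n n] by simp
qed

lemma mult_id_minus_eq_0D: "mult_l2 (\<lambda>z. z - l) x = 0 \<Longrightarrow> x = 0"
  by (rule mult_l2_eq_0D[OF ess_bounded_id_minus eventually_mono[OF AE_circle_neq[of l]]]) simp_all

lemma mult_cnj_minus_eq_0D: "mult_l2 (\<lambda>z. cnj z - cnj l) x = 0 \<Longrightarrow> x = 0"
  by (rule mult_l2_eq_0D[OF ess_bounded_cnj_minus eventually_mono[OF AE_circle_neq[of l]]]) simp_all

lemma mult_id_minus: "mult_l2 (\<lambda>z. z - l) x = mult_l2 (\<lambda>z. z) x - scaleC_l2 l x"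
  by (simp add: mult_l2_symbol_diff ess_bounded_id ess_bounded_const ess_bounded_id_minus mult_l2_const)

lemma mult_cnj_minus: "mult_l2 (\<lambda>z. cnj z - cnj l) x = mult_l2 cnj x - scaleC_l2 (cnj l) x"
  by (simp add: mult_l2_symbol_diff ess_bounded_conj ess_bounded_const ess_bounded_cnj_minus mult_l2_const)

lemma coef_mult_cnj_minus:
  "coef (mult_l2 (\<lambda>z. cnj z - cnj l) x) n = coef x (Suc n) - cnj l * coef x n"
  using coef_mult_cnj[of x n]
  by (simp add: mult_cnj_minus coef_def cinner_diff_left cinner_scale_left)

lemma mult_commute_l2:
  "ess_bounded \<phi> \<Longrightarrow> ess_bounded \<psi> \<Longrightarrow> mult_l2 \<phi> (mult_l2 \<psi> x) = mult_l2 \<psi> (mult_l2 \<phi> x)"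
  by (simp add: mult_mult_l2 mult.commute)

lemma coef_cnj_0: "coef (cnj_l2 x) 0 = cnj (coef x 0)"
  by (cases x)
    (simp add: coef_def zpow_0 l2_of_cnj cinner_l2_of square_integrable_cnj square_integrable_def[of "\<lambda>z. 1"])

text \<open>After conjugation and multiplication by \<open>cnj z\<close>, the equation says that the coefficients of
  nonnegative index form a geometric sequence with first term \<open>cnj c\<close> and ratio \<open>cnj l\<close>. It covers the
  circle and the exterior at once.\<close>

lemma resolvent_const_exterior:
  assumes l: "cmod l \<ge> 1" and m: "coef m 0 = 0"
    and eq: "mult_l2 (\<lambda>z. z - l) m = scaleC_l2 c (zpow 0)"
  shows "c = 0"
proof -
  let ?g = "cnj_l2 m"
  have "mult_l2 (\<lambda>z. cnj z - cnj l) ?g = cnj_l2 (mult_l2 (\<lambda>z. z - l) m)"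
    by (cases m) (simp add: l2_of_cnj l2_of_mult ess_bounded_id_minus ess_bounded_cnj_minus
        square_integrable_cnj square_integrable_mult)
  also have "\<dots> = scaleC_l2 (cnj c) (zpow 0)"
    by (simp add: eq zpow_0 l2_of_scaleC l2_of_cnj square_integrable_def)
  finally have g: "coef ?g (Suc n) - cnj l * coef ?g n = (if n = 0 then cnj c else 0)" for n
    using coef_mult_cnj_minus[of l ?g n] by (auto simp: coef_def cinner_scale_left cinner_zpow)
  have "coef (mult_l2 cnj ?g) (Suc n) = cnj l * coef (mult_l2 cnj ?g) n" for n
    using g[of "Suc n"] by (simp add: coef_mult_cnj)
  then have "coef (mult_l2 cnj ?g) 0 = 0"
    using l by (intro coef_eq_0_if_geometric[of "cnj l"]) auto
  then show ?thesis
    using g[of 0] m by (simp add: coef_mult_cnj coef_cnj_0)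
qed

text \<open>Membership of \<open>(z - l) x\<close> in the model space splits into two conditions. Being in \<open>H2\<close> forces
  \<open>(z - l) m\<close> into \<open>H2\<close>; as \<open>m\<close> is orthogonal to \<open>H2\<close>, multiplication by \<open>z\<close> can create only a constant
  term \<open>c\<close>. Being orthogonal to \<open>\<theta> H2\<close> then determines \<open>(z - l) p\<close>, because the projection of
  \<open>c * cnj \<theta>\<close> onto \<open>H2\<close> is the constant \<open>c * cnj (\<theta> 0)\<close>.\<close>

lemma ker_shift_equations:
  assumes \<theta>: "inner_function \<theta>" and x: "x \<in> ker_dual_tto \<theta> (\<lambda>z. z - l)"
  obtains m p c where "x = m + mult_l2 (radial_limit \<theta>) p" "m \<in> ortho_compl H2" "p \<in> H2"
    "mult_l2 (\<lambda>z. z - l) m = scaleC_l2 c (zpow 0)"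
    "mult_l2 (\<lambda>z. z - l) p = scaleC_l2 (- c * cnj (\<theta> 0)) (zpow 0)"
proof -
  let ?t = "radial_limit \<theta>" and ?M = "mult_l2 (\<lambda>z. z - l)"
  have x': "x \<in> ortho_compl (model_space \<theta>)" "?M x \<in> model_space \<theta>"
    using x by (simp_all add: mem_ker_dual_tto_iff[OF \<theta>])
  obtain m p where mp: "x = m + mult_l2 ?t p" "m \<in> ortho_compl H2" "p \<in> H2"
    using mem_ortho_model_space[OF \<theta> x'(1)] .
  have y: "?M x = ?M m + mult_l2 ?t (?M p)"
    unfolding mp(1) mult_l2_add[OF ess_bounded_id_minus]
    by (simp only: mult_commute_l2[OF ess_bounded_id_minus inner_ess_bounded[OF \<theta>]])
  have Mp: "?M p \<in> H2"
    by (rule mult_mem_H2[OF bounded_analytic_id_minus mp(3)])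
  have "?M x - mult_l2 ?t (?M p) \<in> H2"
    using x'(2) by (intro H2_diff mult_inner_mem_H2 \<theta> Mp) (simp add: mem_model_space_iff)
  then have Mm: "?M m \<in> H2" by (simp add: y)
  have "coef (?M m) (Suc n) = 0" for n
  proof -
    have "coef (mult_l2 (\<lambda>z. z) m) (Suc n) = coef m n"
      using coef_mult_cnj[of "mult_l2 (\<lambda>z. z) m" n] by (simp add: mult_cnj_id)
    then show ?thesis
      using mp(2) by (simp add: mult_id_minus coef_def cinner_diff_left cinner_scale_left
          mem_ortho_H2_iff)
  qed
  then obtain c where c: "?M m = scaleC_l2 c (zpow 0)"
    using H2_const[OF Mm] by blast
  \<comment> \<open>the analytic part of \<open>cnj \<theta>\<close> times \<open>(z - l) x\<close>\<close>
  let ?v = "scaleC_l2 (c * cnj (\<theta> 0)) (zpow 0) + ?M p"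
  have "cinner_l2 ?v h = 0" if h: "h \<in> H2" for h
  proof -
    have "0 = cinner_l2 (?M x) (mult_l2 ?t h)"
      using x'(2) h by (simp add: mem_model_space_iff)
    also have "\<dots> = c * cinner_l2 (zpow 0) (mult_l2 ?t h) + cinner_l2 (?M p) h"
      by (simp add: y c cinner_add_left cinner_scale_left cinner_mult_inner[OF \<theta>])
    also have "cinner_l2 (zpow 0) (mult_l2 ?t h) = cnj (\<theta> 0) * cinner_l2 (zpow 0) h"
      using coef_0_mult_inner[OF \<theta> h]
      by (subst (1 2) cinner_commute) (simp add: coef_def)
    finally show ?thesis
      by (simp add: cinner_add_left cinner_scale_left mult.assoc)
  qed
  then have "?v = 0"
    by (intro H2_ortho_eq_0 H2_add H2_scale zpow_mem_H2 Mp) (simp add: ortho_compl_def)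
  then have "?M p = - scaleC_l2 (c * cnj (\<theta> 0)) (zpow 0)"
    by (simp add: add_eq_0_iff)
  then have "?M p = scaleC_l2 (- c * cnj (\<theta> 0)) (zpow 0)"
    by (simp add: l2.scale_minus_left)
  with mp c show ?thesis using that by blast
qed

lemma ker_shift_exterior:
  assumes \<theta>: "inner_function \<theta>" and l: "cmod l \<ge> 1"
  shows "ker_dual_tto \<theta> (\<lambda>z. z - l) = {0}"
proof -
  have "x = 0" if x: "x \<in> ker_dual_tto \<theta> (\<lambda>z. z - l)" for x
  proof -
    obtain m p c where d: "x = m + mult_l2 (radial_limit \<theta>) p" "m \<in> ortho_compl H2" "p \<in> H2"
      "mult_l2 (\<lambda>z. z - l) m = scaleC_l2 c (zpow 0)"
      "mult_l2 (\<lambda>z. z - l) p = scaleC_l2 (- c * cnj (\<theta> 0)) (zpow 0)"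
      using ker_shift_equations[OF \<theta> x] .
    have "c = 0"
      using d(2) by (intro resolvent_const_exterior[OF l _ d(4)]) (simp add: mem_ortho_H2_iff)
    then have "m = 0" "p = 0"
      using d(4,5) by (auto intro: mult_id_minus_eq_0D)
    then show ?thesis by (simp add: d(1))
  qed
  then show ?thesis using zero_mem_ker_dual_tto[OF \<theta>] by blast
qed

text \<open>Inside the disk the equation for \<open>p\<close> makes \<open>p\<close> a multiple of \<open>1 / (z - l)\<close>, which is orthogonal to
  \<open>H2\<close>; so \<open>p = 0\<close>, and the constant \<open>c * cnj (\<theta> 0)\<close> has to vanish. Stating the kernel with the condition
  \<open>c * \<theta> 0 = 0\<close> covers both alternatives for \<open>\<theta> 0\<close>.\<close>

lemma ker_shift_disk:
  assumes \<theta>: "inner_function \<theta>" and l: "cmod l < 1"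
  shows "ker_dual_tto \<theta> (\<lambda>z. z - l) = {scaleC_l2 c (l2_of (\<lambda>z. 1 / (z - l))) |c. c * \<theta> 0 = 0}"
proof -
  let ?k = "l2_of (\<lambda>z. 1 / (z - l))"
  have "\<exists>c. x = scaleC_l2 c ?k \<and> c * \<theta> 0 = 0" if x: "x \<in> ker_dual_tto \<theta> (\<lambda>z. z - l)" for x
  proof -
    obtain m p c where d: "x = m + mult_l2 (radial_limit \<theta>) p" "m \<in> ortho_compl H2" "p \<in> H2"
      "mult_l2 (\<lambda>z. z - l) m = scaleC_l2 c (zpow 0)"
      "mult_l2 (\<lambda>z. z - l) p = scaleC_l2 (- c * cnj (\<theta> 0)) (zpow 0)"
      using ker_shift_equations[OF \<theta> x] .
    have "p \<in> ortho_compl H2"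
      unfolding mult_id_minus_eq_const[OF l d(5)]
      by (intro ortho_compl_scale cauchy_kernel_ortho_H2 l)
    then have "p = 0" by (intro H2_ortho_eq_0 d)
    then have "c * \<theta> 0 = 0"
      using d(5) zpow_nonzero by (simp add: eq_commute[of 0])
    then show ?thesis
      using mult_id_minus_eq_const[OF l d(4)] d(1) \<open>p = 0\<close> by auto
  qed
  moreover have "scaleC_l2 c ?k \<in> ker_dual_tto \<theta> (\<lambda>z. z - l)" if c: "c * \<theta> 0 = 0" for c
  proof -
    have "mult_l2 (\<lambda>z. z - l) ?k = mult_l2 (\<lambda>z. z - l) (mult_l2 (\<lambda>z. 1 / (z - l)) (zpow 0))"
      by (simp add: mult_zpow_0 cauchy_kernel_ess_bounded l)
    also have "\<dots> = zpow 0"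
      by (intro mult_unit_l2 ess_bounded_id_minus cauchy_kernel_ess_bounded l AE_circle_I) (use l in auto)
    finally have "mult_l2 (\<lambda>z. z - l) (scaleC_l2 c ?k) = scaleC_l2 c (zpow 0)"
      by (simp add: mult_l2_scale ess_bounded_id_minus)
    moreover have "cinner_l2 (scaleC_l2 c (zpow 0)) (mult_l2 (radial_limit \<theta>) h) = 0" if "h \<in> H2" for h
      using coef_0_mult_inner[OF \<theta> that] c
      by (subst cinner_commute) (auto simp: cinner_scale_right coef_def)
    ultimately have "mult_l2 (\<lambda>z. z - l) (scaleC_l2 c ?k) \<in> model_space \<theta>"
      by (simp add: mem_model_space_iff H2_scale zpow_mem_H2)
    then show ?thesis
      by (simp add: mem_ker_dual_tto_iff[OF \<theta>] ortho_H2_subset_ortho_model ortho_compl_scale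
          cauchy_kernel_ortho_H2 l)
  qed
  ultimately show ?thesis by blast
qed

text \<open>The symbol is now conjugate analytic, so multiplying \<open>m\<close> keeps it orthogonal to \<open>H2\<close>, and testing
  against \<open>\<theta> H2\<close> isolates \<open>p\<close>.\<close>

lemma ker_conj_shift_equations:
  assumes \<theta>: "inner_function \<theta>" and x: "x \<in> ker_dual_tto \<theta> (\<lambda>z. cnj z - cnj l)"
  obtains m p where "x = m + mult_l2 (radial_limit \<theta>) p" "m \<in> ortho_compl H2" "p \<in> H2"
    "mult_l2 (\<lambda>z. cnj z - cnj l) m \<in> ortho_compl H2"
    "mult_l2 (\<lambda>z. cnj z - cnj l) p \<in> ortho_compl H2"
    "mult_l2 (\<lambda>z. cnj z - cnj l) m + mult_l2 (radial_limit \<theta>) (mult_l2 (\<lambda>z. cnj z - cnj l) p) \<in> H2"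
proof -
  let ?t = "radial_limit \<theta>" and ?M = "mult_l2 (\<lambda>z. cnj z - cnj l)"
  have x': "x \<in> ortho_compl (model_space \<theta>)" "?M x \<in> model_space \<theta>"
    using x by (simp_all add: mem_ker_dual_tto_iff[OF \<theta>])
  obtain m p where mp: "x = m + mult_l2 ?t p" "m \<in> ortho_compl H2" "p \<in> H2"
    using mem_ortho_model_space[OF \<theta> x'(1)] .
  have y: "?M x = ?M m + mult_l2 ?t (?M p)"
    unfolding mp(1) mult_l2_add[OF ess_bounded_cnj_minus]
    by (simp only: mult_commute_l2[OF ess_bounded_cnj_minus inner_ess_bounded[OF \<theta>]])
  have Mm: "?M m \<in> ortho_compl H2"
    using mult_cnj_ortho_H2[OF bounded_analytic_id_minus mp(2), of l] by simp
  have "cinner_l2 (?M p) h = 0" if h: "h \<in> H2" for h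
  proof -
    have "0 = cinner_l2 (?M x) (mult_l2 ?t h)"
      using x'(2) h by (simp add: mem_model_space_iff)
    also have "\<dots> = cinner_l2 (?M p) h"
      using Mm mult_inner_mem_H2[OF \<theta> h]
      by (simp add: y cinner_add_left cinner_mult_inner[OF \<theta>] ortho_compl_def)
    finally show ?thesis by simp
  qed
  then have "?M p \<in> ortho_compl H2" by (simp add: ortho_compl_def)
  moreover have "?M m + mult_l2 ?t (?M p) \<in> H2"
    using x'(2) by (simp add: mem_model_space_iff flip: y)
  ultimately show ?thesis using mp Mm that by blast
qed

text \<open>That \<open>(cnj z - cnj l) p\<close> is orthogonal to \<open>H2\<close> is the recursion \<open>p\<^sub>n\<^sub>+\<^sub>1 = cnj l * p\<^sub>n\<close> for the
  Fourier coefficients.\<close>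

lemma ker_conj_shift_exterior:
  assumes \<theta>: "inner_function \<theta>" and l: "cmod l \<ge> 1"
  shows "ker_dual_tto \<theta> (\<lambda>z. cnj z - cnj l) = {0}"
proof -
  let ?M = "mult_l2 (\<lambda>z. cnj z - cnj l)"
  have "x = 0" if x: "x \<in> ker_dual_tto \<theta> (\<lambda>z. cnj z - cnj l)" for x
  proof -
    obtain m p where d: "x = m + mult_l2 (radial_limit \<theta>) p" "m \<in> ortho_compl H2" "p \<in> H2"
      "?M m \<in> ortho_compl H2" "?M p \<in> ortho_compl H2"
      "?M m + mult_l2 (radial_limit \<theta>) (?M p) \<in> H2"
      using ker_conj_shift_equations[OF \<theta> x] .
    have "coef p (Suc n) = cnj l * coef p n" for n
      using d(5) coef_mult_cnj_minus[of l p n] by (simp add: mem_ortho_H2_iff)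
    then have "coef p n = 0" for n
      using l by (intro coef_eq_0_if_geometric[of "cnj l"]) auto
    then have "p = 0"
      by (intro H2_ortho_eq_0 d) (simp add: mem_ortho_H2_iff)
    then have "?M m = 0"
      using d(4,6) by (intro H2_ortho_eq_0) simp_all
    then have "m = 0" by (rule mult_cnj_minus_eq_0D)
    with \<open>p = 0\<close> show ?thesis by (simp add: d(1))
  qed
  then show ?thesis using zero_mem_ker_dual_tto[OF \<theta>] by blast
qed

lemma mult_id_cnj_minus:
  "mult_l2 (\<lambda>z. z) (mult_l2 (\<lambda>z. cnj z - cnj l) x) = mult_l2 (\<lambda>z. 1 - cnj l * z) x"
  unfolding mult_mult_l2[OF ess_bounded_id ess_bounded_cnj_minus]
  by (intro mult_l2_cong_AE ess_bounded_mult ess_bounded_id ess_bounded_cnj_minus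
      ess_bounded_one_minus AE_circle_I) (simp add: algebra_simps circle_mult_cnj)

lemma mult_cnj_minus_szego:
  assumes "cmod l < 1"
  shows "mult_l2 (\<lambda>z. cnj z - cnj l) (l2_of (szego l)) = mult_l2 cnj (zpow 0)"
proof -
  note k = bounded_analytic_ess_bounded[OF bounded_analytic_szego[OF assms]]
  have "mult_l2 (\<lambda>z. 1 - cnj l * z) (l2_of (szego l)) = mult_l2 (\<lambda>z. 1 - cnj l * z) (mult_l2 (szego l) (zpow 0))"
    by (simp add: mult_zpow_0 k)
  also have "\<dots> = zpow 0"
    by (intro mult_unit_l2 k ess_bounded_one_minus AE_circle_I)
      (use one_minus_nonzero[OF assms] in \<open>auto simp: szego_def\<close>)
  finally have "mult_l2 (\<lambda>z. z) (mult_l2 (\<lambda>z. cnj z - cnj l) (l2_of (szego l))) = zpow 0"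
    by (simp add: mult_id_cnj_minus)
  then show ?thesis
    using mult_cnj_id by metis
qed

lemma mult_cnj_zpow_0_ortho: "mult_l2 cnj (zpow 0) \<in> ortho_compl H2"
  unfolding mem_ortho_H2_iff coef_mult_cnj by (simp add: coef_def cinner_zpow)

text \<open>Multiplied by \<open>z\<close>, the condition on \<open>p\<close> makes \<open>(1 - cnj l * z) p\<close> a constant \<open>c\<close>, so \<open>p\<close> is a multiple
  of the Szego kernel and \<open>(cnj z - cnj l) \<theta> p = c * cnj z * \<theta>\<close>. Of this, only \<open>c * \<theta> 0 * cnj z\<close> lies
  outside \<open>H2\<close>, and it has to be cancelled by \<open>(cnj z - cnj l) m\<close>. That would make \<open>m\<close> a multiple of the
  Szego kernel too, which lies in \<open>H2\<close>; hence \<open>m = 0\<close> and \<open>c * \<theta> 0 = 0\<close>.\<close>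

lemma ker_conj_shift_disk:
  assumes \<theta>: "inner_function \<theta>" and l: "cmod l < 1"
  shows "ker_dual_tto \<theta> (\<lambda>z. cnj z - cnj l) =
    {scaleC_l2 c (mult_l2 (radial_limit \<theta>) (l2_of (szego l))) |c. c * \<theta> 0 = 0}"
proof -
  let ?t = "radial_limit \<theta>" and ?M = "mult_l2 (\<lambda>z. cnj z - cnj l)"
  note t = inner_ess_bounded[OF \<theta>]
  let ?k = "l2_of (szego l)"
  note k = szego_mem_H2[OF l]
  have t_H2: "l2_of ?t \<in> H2" and t_0: "coef (l2_of ?t) 0 = \<theta> 0"
    using h2_boundary_bounded_analytic[OF inner_bounded_analytic[OF \<theta>]] coef_0_h2_boundary
    by (auto simp: mem_H2_iff)
  have tM: "mult_l2 ?t (?M (scaleC_l2 c ?k)) = scaleC_l2 c (mult_l2 cnj (l2_of ?t))" for c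
    by (simp add: mult_l2_scale ess_bounded_cnj_minus mult_cnj_minus_szego[OF l] t
        mult_commute_l2[OF t ess_bounded_conj] mult_zpow_0)
  have "\<exists>c. x = scaleC_l2 c (mult_l2 ?t ?k) \<and> c * \<theta> 0 = 0"
    if x: "x \<in> ker_dual_tto \<theta> (\<lambda>z. cnj z - cnj l)" for x
  proof -
    obtain m p where d: "x = m + mult_l2 ?t p" "m \<in> ortho_compl H2" "p \<in> H2"
      "?M m \<in> ortho_compl H2" "?M p \<in> ortho_compl H2" "?M m + mult_l2 ?t (?M p) \<in> H2"
      using ker_conj_shift_equations[OF \<theta> x] .
    have "coef (mult_l2 (\<lambda>z. 1 - cnj l * z) p) (Suc n) = 0" for n
    proof -
      have "coef (mult_l2 (\<lambda>z. 1 - cnj l * z) p) (Suc n) = coef (?M p) n"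
        unfolding mult_id_cnj_minus[symmetric] coef_mult_cnj[symmetric] mult_cnj_id ..
      then show ?thesis using d(5) by (simp add: mem_ortho_H2_iff)
    qed
    from H2_const[OF mult_mem_H2[OF bounded_analytic_one_minus d(3)] this]
    obtain c where "mult_l2 (\<lambda>z. 1 - cnj l * z) p = scaleC_l2 c (zpow 0)" by blast
    then have p: "p = scaleC_l2 c ?k"
      by (rule mult_one_minus_eq_const[OF l])
    let ?w = "scaleC_l2 (c * \<theta> 0) (mult_l2 cnj (zpow 0))"
    \<comment> \<open>\<open>?a\<close> vanishes at the origin, so it can be divided by \<open>z\<close> within \<open>H2\<close>\<close>
    let ?a = "l2_of ?t - scaleC_l2 (\<theta> 0) (zpow 0)"
    have "mult_l2 cnj ?a \<in> H2"
      using t_0 by (intro mult_cnj_mem_H2 H2_diff t_H2 H2_scale zpow_mem_H2)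
        (simp add: coef_def cinner_diff_left cinner_scale_left cinner_zpow)
    then have "(?M m + mult_l2 ?t (?M p)) - scaleC_l2 c (mult_l2 cnj ?a) \<in> H2"
      by (intro H2_diff d H2_scale)
    also have "(?M m + mult_l2 ?t (?M p)) - scaleC_l2 c (mult_l2 cnj ?a) = ?M m + ?w"
      by (simp add: p tM mult_l2_diff mult_l2_scale ess_bounded_conj l2.scale_right_diff_distrib)
    finally have "?M m + ?w \<in> H2" .
    moreover have "?M m + ?w \<in> ortho_compl H2"
      by (intro ortho_compl_add d ortho_compl_scale mult_cnj_zpow_0_ortho)
    ultimately have "?M m + ?w = 0"
      by (rule H2_ortho_eq_0)
    then have Mm: "?M m = - ?w"
      by (simp add: add_eq_0_iff2)
    have "mult_l2 (\<lambda>z. 1 - cnj l * z) m = mult_l2 (\<lambda>z. z) (scaleC_l2 (- (c * \<theta> 0)) (mult_l2 cnj (zpow 0)))"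
      unfolding mult_id_cnj_minus[symmetric] Mm by (simp add: l2.scale_minus_left)
    also have "\<dots> = scaleC_l2 (- (c * \<theta> 0)) (zpow 0)"
      by (simp only: mult_l2_scale[OF ess_bounded_id] mult_id_cnj)
    finally have "m = scaleC_l2 (- (c * \<theta> 0)) ?k"
      by (rule mult_one_minus_eq_const[OF l])
    then have "m \<in> H2"
      by (simp add: H2_scale k del: l2.scale_minus_left)
    then have "m = 0"
      by (intro H2_ortho_eq_0 d)
    then have "c * \<theta> 0 = 0"
    proof -
      have "scaleC_l2 (- (c * \<theta> 0)) (zpow 0) = 0"
        using \<open>mult_l2 (\<lambda>z. 1 - cnj l * z) m = mult_l2 (\<lambda>z. z) _\<close>
          \<open>mult_l2 (\<lambda>z. z) _ = scaleC_l2 (- (c * \<theta> 0)) (zpow 0)\<close> \<open>m = 0\<close> by simp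
      then show ?thesis using zpow_nonzero by (simp add: l2.scale_eq_0_iff)
    qed
    then show ?thesis
      using \<open>m = 0\<close> d(1) p by (auto simp: mult_l2_scale t)
  qed
  moreover have "scaleC_l2 c (mult_l2 ?t ?k) \<in> ker_dual_tto \<theta> (\<lambda>z. cnj z - cnj l)"
    if c: "c * \<theta> 0 = 0" for c
  proof (cases "c = 0")
    case True
    then show ?thesis using zero_mem_ker_dual_tto[OF \<theta>] by simp
  next
    case False
    have eq: "?M (scaleC_l2 c (mult_l2 ?t ?k)) = mult_l2 ?t (?M (scaleC_l2 c ?k))"
      by (simp add: mult_l2_scale ess_bounded_cnj_minus t mult_commute_l2[OF ess_bounded_cnj_minus t])
    have "mult_l2 ?t (?M (scaleC_l2 c ?k)) \<in> H2"
      unfolding tM using False c t_0 by (intro H2_scale mult_cnj_mem_H2 t_H2) simp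
    moreover have "?M (scaleC_l2 c ?k) \<in> ortho_compl H2"
      by (simp add: mult_l2_scale ess_bounded_cnj_minus mult_cnj_minus_szego[OF l] ortho_compl_scale
          mult_cnj_zpow_0_ortho)
    ultimately have "mult_l2 ?t (?M (scaleC_l2 c ?k)) \<in> model_space \<theta>"
      by (simp add: mem_model_space_iff cinner_mult_inner[OF \<theta>] ortho_compl_def)
    then show ?thesis
      by (simp add: mem_ker_dual_tto_iff[OF \<theta>] eq ortho_compl_scale mult_inner_ortho_model k)
  qed
  ultimately show ?thesis by blast
qed

theorem theorem8p12:
  fixes \<theta> :: "complex \<Rightarrow> complex" and l :: complex
  assumes "inner_function \<theta>"
  shows "(l \<in> sphere 0 1 \<union> (UNIV - (ball 0 1 \<union> sphere 0 1)) \<or> (l \<in> ball 0 1 \<and> \<theta> 0 \<noteq> 0) \<longrightarrow>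
            ker_dual_tto \<theta> (\<lambda>z. z - l) = {0} \<and>
            ker_dual_tto \<theta> (\<lambda>z. cnj z - cnj l) = {0}) \<and>
         (l \<in> ball 0 1 \<and> \<theta> 0 = 0 \<longrightarrow>
            ker_dual_tto \<theta> (\<lambda>z. z - l) = l2.span {l2_of (\<lambda>z. 1 / (z - l))} \<and>
            l2.span {l2_of (\<lambda>z. 1 / (z - l))} \<subseteq> H2_minus \<and>
            ker_dual_tto \<theta> (\<lambda>z. cnj z - cnj l) =
              l2.span {l2_of (\<lambda>z. radial_limit \<theta> z / (1 - cnj l * z))} \<and>
            l2.span {l2_of (\<lambda>z. radial_limit \<theta> z / (1 - cnj l * z))} \<subseteq> inner_H2 \<theta>)"
proof (intro conjI impI; elim disjE conjE)
  assume "l \<in> sphere 0 1 \<union> (UNIV - (ball 0 1 \<union> sphere 0 1))"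
  then have l: "cmod l \<ge> 1" by auto
  show "ker_dual_tto \<theta> (\<lambda>z. z - l) = {0}" "ker_dual_tto \<theta> (\<lambda>z. cnj z - cnj l) = {0}"
    by (fact ker_shift_exterior[OF assms l] ker_conj_shift_exterior[OF assms l])+
next
  assume "l \<in> ball 0 1" "\<theta> 0 \<noteq> 0"
  then have l: "cmod l < 1" by simp
  show "ker_dual_tto \<theta> (\<lambda>z. z - l) = {0}" "ker_dual_tto \<theta> (\<lambda>z. cnj z - cnj l) = {0}"
    using \<open>\<theta> 0 \<noteq> 0\<close> by (auto simp: ker_shift_disk[OF assms l] ker_conj_shift_disk[OF assms l])
next
  assume "l \<in> ball 0 1" "\<theta> 0 = 0"
  then have l: "cmod l < 1" by simp
  have k: "ess_bounded (szego l)"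
    by (rule bounded_analytic_ess_bounded[OF bounded_analytic_szego[OF l]])
  have quot: "l2_of (\<lambda>z. radial_limit \<theta> z / (1 - cnj l * z)) = mult_l2 (radial_limit \<theta>) (l2_of (szego l))"
    by (simp add: l2_of_mult[OF ess_bounded_square_integrable[OF k] inner_ess_bounded[OF assms]] szego_def)
  show "ker_dual_tto \<theta> (\<lambda>z. z - l) = l2.span {l2_of (\<lambda>z. 1 / (z - l))}"
    using \<open>\<theta> 0 = 0\<close> by (auto simp: ker_shift_disk[OF assms l] l2.span_singleton)
  show "ker_dual_tto \<theta> (\<lambda>z. cnj z - cnj l) = l2.span {l2_of (\<lambda>z. radial_limit \<theta> z / (1 - cnj l * z))}"
    using \<open>\<theta> 0 = 0\<close> by (auto simp: ker_conj_shift_disk[OF assms l] l2.span_singleton quot)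
  show "l2.span {l2_of (\<lambda>z. 1 / (z - l))} \<subseteq> H2_minus"
    by (auto simp: l2.span_singleton intro: H2_minus_scale cauchy_kernel_mem_H2_minus[OF l])
  have "scaleC_l2 c (mult_l2 (radial_limit \<theta>) (l2_of (szego l))) \<in> inner_H2 \<theta>" for c
    using H2_scale[OF szego_mem_H2[OF l]]
    by (auto simp: inner_H2_def mult_l2_scale[OF inner_ess_bounded[OF assms], symmetric])
  then show "l2.span {l2_of (\<lambda>z. radial_limit \<theta> z / (1 - cnj l * z))} \<subseteq> inner_H2 \<theta>"
    by (auto simp: l2.span_singleton quot)
qed

end
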